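(* Let $n,m$ be positive integers and let $\alpha_1,\dots,\alpha_n$ be the simple roots of type $A_n$. There exists a bijection $\omega_n:\mathcal{D}^m_n\to\mathcal{R}^m_n$ such that for every $i\in\{1,\dots,n\}$ and every $D\in\mathcal{D}^m_n$, the facet $D$ contains the negative simple root $-\alpha_i$ if and only if the hyperplane $H_{\alpha_i,m}$ is a separating wall of the region $\omega_n(D)$.
   Context: Type $A_n$: let $\varepsilon_1,\dots,\varepsilon_{n+1}$ be the standard basis of $\mathbb{R}^{n+1}$, $V=\{x\in\mathbb{R}^{n+1}:\sum x_i=0\}$ with the standard inner product $\langle\cdot,\cdot\rangle$. The positive roots are $\alpha_{ij}=\varepsilon_i-\varepsilon_{j+1}$ for $1\le i\le j\le n$, and the simple roots are $\alpha_i=\alpha_{ii}=\varepsilon_i-\varepsilon_{i+1}$. For a root $\alpha$ and $k\in\mathbb{Z}$ let $H_{\alpha,k}=\{v\in V:\langle v,\alpha\rangle=k\}$. The $m$-Catalan arrangement $\mathrm{Cat}^m(A_n)$ is the set of hyperplanes $H_{\alpha,k}$ with $\alpha$ a positive root and $0\le k\le m$; its regions are the connected components of the complement of the union of these hyperplanes in $V$. A region is dominant if it lies in the dominant chamber $\{v\in V:\langle v,\alpha\rangle\ge 0 \text{ for all positive roots }\alpha\}$. $\mathcal{R}^m_n$ denotes the set of dominant regions of $\mathrm{Cat}^m(A_n)$. A wall of a region $R$ is a hyperplane of the arrangement supporting a facet of $R$; it is a separating wall if $R$ and the origin lie in different open half-spaces determined by it. Facets of the $m$-generalized cluster complex $\Delta^m(A_n)$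 (Fomin–Reading), realized as dissections: let $P$ be a convex polygon with $m(n+1)+2$ vertices labeled $0,1,\dots,m(n+1)+1$ counterclockwise. An $m$-diagonal is a diagonal of $P$ dividing it into two polygons each of whose number of vertices is congruent to $2$ modulo $m$. An $m$-dissection is a set of $n$ pairwise non-crossing (in the interior) $m$-diagonals (equivalently a subdivision of $P$ into $(m+2)$-gons). $\mathcal{D}^m_n$ is the set of $m$-dissections of $P$; these are the facets of $\Delta^m(A_n)$. The negative simple roots are identified with the following diagonals: for $1\le i\le \frac{n+1}{2}$, $-\alpha_{2i-1}$ is the diagonal joining vertices $(i-1)m$ and $(n+1-i)m+1$; for $1\le i\le \frac n2$, $-\alpha_{2i}$ is the diagonal joining vertices $im$ and $(n+1-i)m+1$. A dissection $D$ contains $-\alpha_i$ if the diagonal identified with $-\alpha_i$ belongs to $D$. *)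

theory Defs
  imports "HOL-Analysis.Analysis"
begin

text \<open>Points of R^(n+1) are functions nat => real supported on the indices 1..n+1
  (coordinate i is the coefficient of epsilon_i). The type nat => real carries the
  product topology; on the finite-dimensional subspace of functions supported on
  {1..n+1} this is the Euclidean topology.\<close>

definition Vsp :: "nat \<Rightarrow> (nat \<Rightarrow> real) set" where
  "Vsp n = {x. (\<forall>i. i \<notin> {1..n+1} \<longrightarrow> x i = 0) \<and> (\<Sum>i=1..n+1. x i) = 0}"

definition ip :: "nat \<Rightarrow> (nat \<Rightarrow> real) \<Rightarrow> (nat \<Rightarrow> real) \<Rightarrow> real" where
  "ip n x y = (\<Sum>i=1..n+1. x i * y i)"

definition eps :: "nat \<Rightarrow> nat \<Rightarrow> real" where
  "eps i = (\<lambda>l. if l = i then 1 else 0)"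

definition posroot :: "nat \<Rightarrow> nat \<Rightarrow> (nat \<Rightarrow> real)" where
  "posroot i j = (\<lambda>l. eps i l - eps (j+1) l)"

definition is_posroot :: "nat \<Rightarrow> (nat \<Rightarrow> real) \<Rightarrow> bool" where
  "is_posroot n a \<longleftrightarrow> (\<exists>i j. 1 \<le> i \<and> i \<le> j \<and> j \<le> n \<and> a = posroot i j)"

definition simpleroot :: "nat \<Rightarrow> (nat \<Rightarrow> real)" where
  "simpleroot i = posroot i i"

definition hyp :: "nat \<Rightarrow> (nat \<Rightarrow> real) \<Rightarrow> int \<Rightarrow> (nat \<Rightarrow> real) set" where
  "hyp n a k = {v \<in> Vsp n. ip n v a = of_int k}"

definition cat_arr :: "nat \<Rightarrow> nat \<Rightarrow> (nat \<Rightarrow> real) set set" where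
  "cat_arr n m = {hyp n a (int k) | a k. is_posroot n a \<and> k \<le> m}"

definition cat_complement :: "nat \<Rightarrow> nat \<Rightarrow> (nat \<Rightarrow> real) set" where
  "cat_complement n m = Vsp n - \<Union>(cat_arr n m)"

definition cat_regions :: "nat \<Rightarrow> nat \<Rightarrow> (nat \<Rightarrow> real) set set" where
  "cat_regions n m = {connected_component_set (cat_complement n m) x | x. x \<in> cat_complement n m}"

definition dominant_chamber :: "nat \<Rightarrow> (nat \<Rightarrow> real) set" where
  "dominant_chamber n = {v \<in> Vsp n. \<forall>a. is_posroot n a \<longrightarrow> ip n v a \<ge> 0}"

definition dom_regions :: "nat \<Rightarrow> nat \<Rightarrow> (nat \<Rightarrow> real) set set" where
  "dom_regions n m = {R \<in> cat_regions n m. R \<subseteq> dominant_chamber n}"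

text \<open>H is a wall of R: H is a hyperplane of the arrangement supporting a facet of R,
  i.e. the closure of R meets H in a point lying on no other hyperplane of the arrangement
  (equivalently H \<inter> closure R is (n-1)-dimensional).\<close>
definition is_wall :: "nat \<Rightarrow> nat \<Rightarrow> (nat \<Rightarrow> real) set \<Rightarrow> (nat \<Rightarrow> real) set \<Rightarrow> bool" where
  "is_wall n m H R \<longleftrightarrow> H \<in> cat_arr n m \<and>
     (\<exists>p \<in> closure R \<inter> H. \<forall>H' \<in> cat_arr n m. H' \<noteq> H \<longrightarrow> p \<notin> H')"

definition is_sep_wall :: "nat \<Rightarrow> nat \<Rightarrow> (nat \<Rightarrow> real) \<Rightarrow> int \<Rightarrow> (nat \<Rightarrow> real) set \<Rightarrow> bool" where
  "is_sep_wall n m a k R \<longleftrightarrow> is_wall n m (hyp n a k) R \<and>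
     ((ip n (\<lambda>_. 0) a < of_int k \<and> (\<forall>x\<in>R. ip n x a > of_int k)) \<or>
      (ip n (\<lambda>_. 0) a > of_int k \<and> (\<forall>x\<in>R. ip n x a < of_int k)))"

definition nverts :: "nat \<Rightarrow> nat \<Rightarrow> nat" where
  "nverts n m = m * (n + 1) + 2"

text \<open>A diagonal is a pair (a,b), a < b, of non-adjacent vertices in {0..N-1}.
  It splits P into polygons with b-a+1 and N-(b-a)+1 vertices.\<close>
definition is_mdiag :: "nat \<Rightarrow> nat \<Rightarrow> nat \<times> nat \<Rightarrow> bool" where
  "is_mdiag n m d \<longleftrightarrow> (case d of (a, b) \<Rightarrow>
     a < b \<and> b < nverts n m \<and> 2 \<le> b - a \<and> b - a \<le> nverts n m - 2 \<and>
     (b - a + 1) mod m = 2 mod m \<and> (nverts n m - (b - a) + 1) mod m = 2 mod m)"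

definition crossing :: "nat \<times> nat \<Rightarrow> nat \<times> nat \<Rightarrow> bool" where
  "crossing d e \<longleftrightarrow> (case d of (a, b) \<Rightarrow> case e of (c, d') \<Rightarrow>
     (a < c \<and> c < b \<and> b < d') \<or> (c < a \<and> a < d' \<and> d' < b))"

definition dissections :: "nat \<Rightarrow> nat \<Rightarrow> (nat \<times> nat) set set" where
  "dissections n m = {D. finite D \<and> card D = n \<and> (\<forall>d\<in>D. is_mdiag n m d) \<and>
      (\<forall>d\<in>D. \<forall>e\<in>D. \<not> crossing d e)}"

text \<open>The diagonal identified with -alpha_i (written with smaller endpoint first).\<close>
definition neg_simple_diag :: "nat \<Rightarrow> nat \<Rightarrow> nat \<Rightarrow> nat \<times> nat" where
  "neg_simple_diag n m i =
     (if odd i then (let k = (i + 1) div 2 in ((k - 1) * m, (n + 1 - k) * m + 1))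
      else (let k = i div 2 in (k * m, (n + 1 - k) * m + 1)))"

end

theory Submission
  imports Defs
begin

text \<open>Both sides are matched with the integer sequences \<open>b\<^sub>0, \<dots>, b\<^sub>n\<close> satisfying \<open>b\<^sub>0 = 0\<close> and
  \<open>0 \<le> b\<^sub>i\<^sub>+\<^sub>1 \<le> b\<^sub>i + m\<close>.  For a point \<open>x\<close> of a dominant region, let \<open>b\<^sub>i\<close> count the numbers
  \<open>x\<^sub>j - k\<close> with \<open>1 \<le> j \<le> i\<close> and \<open>1 \<le> k \<le> m\<close> that lie below \<open>x\<^sub>i\<^sub>+\<^sub>1\<close>.  These counts determine the
  region, every sequence arises, and \<open>b\<^sub>i = 0\<close> means \<open>x\<^sub>i - x\<^sub>i\<^sub>+\<^sub>1 > m\<close>, which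
  already forces the hyperplane \<open>x\<^sub>i - x\<^sub>i\<^sub>+\<^sub>1 = m\<close> to be a separating wall.  On the other side, removing the last ear shows
  that there are as many dissections as sequences.  A diagonal of the snake
  of negative simple roots splits the polygon into two
  polygons exactly as a zero splits a sequence into two sequences, so for every set \<open>I\<close> of indices the
  dissections containing the negative simple roots indexed by \<open>I\<close> are equinumerous with the sequences
  vanishing on \<open>I\<close>; inclusion-exclusion then yields the bijection.\<close>

section \<open>Dissections split along a diagonal\<close>

text \<open>The vertex numbers of the two pieces add up to \<open>m * (n + 1) + 4\<close>, so the
  congruence for one piece implies the congruence for the other, and one divisibility
  remains.\<close>

lemma is_mdiag_iff:
  assumes "0 < m"
  shows "is_mdiag n m (a, b) \<longleftrightarrow>
    a + 2 \<le> b \<and> b \<le> m * (n + 1) + 1 \<and> b - a \<le> m * (n + 1) \<and> m dvd b - a - 1"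
proof -
  have *: "(b - a + 1) mod m = 2 mod m \<longleftrightarrow> m dvd b - a - 1" if "a + 2 \<le> b"
    using mod_eq_dvd_iff_nat[of 2 "b - a + 1" m] that by (simp add: numeral_2_eq_2)
  have **: "(nverts n m - (b - a) + 1) mod m = 2 mod m"
    if "a + 2 \<le> b" "b - a \<le> m * (n + 1)" "m dvd b - a - 1"
  proof -
    have "m dvd m * (n + 1) - (b - a - 1)"
      using that(3) by (metis dvd_diff_nat dvd_triv_left)
    moreover have "nverts n m - (b - a) + 1 - 2 = m * (n + 1) - (b - a - 1)"
      using that by (simp add: nverts_def)
    ultimately show ?thesis
      using mod_eq_dvd_iff_nat[of 2 "nverts n m - (b - a) + 1" m] that by (simp add: nverts_def)
  qed
  have "a < b \<and> b < nverts n m \<and> 2 \<le> b - a \<and> b - a \<le> nverts n m - 2 \<longleftrightarrow>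
      a + 2 \<le> b \<and> b \<le> m * (n + 1) + 1 \<and> b - a \<le> m * (n + 1)"
    by (auto simp: nverts_def)
  with * ** show ?thesis
    unfolding is_mdiag_def prod.case by blast
qed

text \<open>The piece on the vertices \<open>a\<close> to \<open>b\<close> is itself the polygon of
  parameter \<open>k\<close>. Sides are excluded by \<open>a + 2 \<le> b\<close>, whence the
  \<open>k + 1\<close>, and the base edge by the upper bound on the length, whence
  \<open>k < n\<close>.\<close>

lemma is_mdiag_length:
  assumes "0 < m" "is_mdiag n m (a, b)"
  obtains k where "k < n" "b = a + 1 + m * (k + 1)" "a \<le> m * (n - k)"
proof -
  note D = assms(2)[unfolded is_mdiag_iff[OF assms(1)]]
  obtain t where t: "b - a - 1 = m * t" using D by (elim conjE dvdE)
  with D have "t \<noteq> 0" by (intro notI) simp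
  then obtain k where k: "t = k + 1" by (cases t) auto
  have b: "b = a + 1 + m * (k + 1)" using D t unfolding k by linarith
  with D have "m * (k + 1) < m * (n + 1)" by linarith
  hence "k < n" using assms(1) by simp
  moreover have "m * (n + 1) = m * (n - k) + m * (k + 1)"
    using \<open>k < n\<close> by (simp flip: distrib_left)
  hence "a \<le> m * (n - k)" using D b by linarith
  ultimately show ?thesis using b that by blast
qed

text \<open>Without the cardinality condition, the notion passes to the two sides of a diagonal
  before it is known how many diagonals lie on each side.\<close>

definition noncrossing_mdiags :: "nat \<Rightarrow> nat \<Rightarrow> (nat \<times> nat) set \<Rightarrow> bool" where
  "noncrossing_mdiags n m D \<longleftrightarrow> (\<forall>d\<in>D. is_mdiag n m d) \<and> (\<forall>d\<in>D. \<forall>e\<in>D. \<not> crossing d e)"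

lemma finite_mdiags: "finite {d. is_mdiag n m d}"
proof (rule finite_subset)
  show "{d. is_mdiag n m d} \<subseteq> {..<nverts n m} \<times> {..<nverts n m}"
    by (auto simp: is_mdiag_def)
qed simp

lemma finite_noncrossing_mdiags: "noncrossing_mdiags n m D \<Longrightarrow> finite D"
  by (rule finite_subset[OF _ finite_mdiags]) (auto simp: noncrossing_mdiags_def)

lemma dissections_eq: "dissections n m = {D. noncrossing_mdiags n m D \<and> card D = n}"
  using finite_noncrossing_mdiags
  unfolding dissections_def noncrossing_mdiags_def by blast

lemma finite_dissections: "finite (dissections n m)"
proof (rule finite_subset)
  show "dissections n m \<subseteq> Pow {d. is_mdiag n m d}" by (auto simp: dissections_def)
qed (simp add: finite_mdiags)

section \<open>Gluing two polygons along a side\<close>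

definition widen :: "nat \<Rightarrow> nat \<Rightarrow> nat \<Rightarrow> nat" where
  "widen v c x = (if x \<le> v then x else x + c)"

definition outer_diag :: "nat \<Rightarrow> nat \<Rightarrow> nat \<times> nat \<Rightarrow> nat \<times> nat" where
  "outer_diag v c = map_prod (widen v c) (widen v c)"

definition inner_diag :: "nat \<Rightarrow> nat \<times> nat \<Rightarrow> nat \<times> nat" where
  "inner_diag v = map_prod ((+) v) ((+) v)"

lemma outer_diag_simp [simp]: "outer_diag v c (a, b) = (widen v c a, widen v c b)"
  and inner_diag_simp [simp]: "inner_diag v (a, b) = (v + a, v + b)"
  by (simp_all add: outer_diag_def inner_diag_def)

lemma widen_less_iff [simp]: "widen v c x < widen v c y \<longleftrightarrow> x < y"
  by (auto simp: widen_def)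

lemma widen_eq_iff [simp]: "widen v c x = widen v c y \<longleftrightarrow> x = y"
  by (auto simp: widen_def)

lemma inj_outer_diag: "inj (outer_diag v c)"
  by (auto simp: inj_def)

lemma inj_inner_diag: "inj (inner_diag v)"
  by (auto simp: inj_def)

lemma crossing_outer_diag [simp]: "crossing (outer_diag v c d) (outer_diag v c e) \<longleftrightarrow> crossing d e"
  by (cases d; cases e) (simp add: crossing_def)

lemma crossing_inner_diag [simp]: "crossing (inner_diag v d) (inner_diag v e) \<longleftrightarrow> crossing d e"
  by (cases d; cases e) (simp add: crossing_def)

lemma crossing_sym: "crossing d e \<longleftrightarrow> crossing e d"
  by (cases d; cases e) (auto simp: crossing_def)

text \<open>Widening changes a length by 0 or by \<open>m * (k + 1)\<close>, which leaves
  divisibility by \<open>m\<close> intact. The side \<open>(v, v + 1)\<close> has to be excluded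
  because it opens up into the gluing diagonal.\<close>

lemma is_mdiag_outer_diag:
  assumes m: "0 < m" and v: "v \<le> m * (n' + 1)" and d: "d \<noteq> (v, v + 1)" "fst d < snd d"
  shows "is_mdiag (n' + k + 1) m (outer_diag v (m * (k + 1)) d) \<longleftrightarrow> is_mdiag n' m d"
proof (cases d)
  case (Pair a b)
  define c where "c = m * (k + 1)"
  have e: "m * (n' + k + 1 + 1) = m * (n' + 1) + c" by (simp add: c_def algebra_simps)
  have "m dvd c" by (simp add: c_def)
  have "m dvd b + c - a - 1 \<longleftrightarrow> m dvd b - a - 1" if "a < b"
  proof -
    have "b + c - a - 1 = (b - a - 1) + c" using that by simp
    thus ?thesis using \<open>m dvd c\<close> by (simp add: dvd_add_left_iff)
  qed
  moreover have "a < b" using d Pair by simp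
  ultimately show ?thesis
    using d v unfolding Pair outer_diag_simp is_mdiag_iff[OF m] e c_def[symmetric]
    by (auto simp: widen_def)
qed

text \<open>Translation preserves lengths. The base edge of the inner polygon is excluded because it
  becomes the gluing diagonal of the larger one.\<close>

lemma is_mdiag_inner_diag:
  assumes m: "0 < m" and v: "v \<le> m * (n' + 1)" and d: "d \<noteq> (0, m * (k + 1) + 1)" "snd d \<le> m * (k + 1) + 1"
  shows "is_mdiag (n' + k + 1) m (inner_diag v d) \<longleftrightarrow> is_mdiag k m d"
proof (cases d)
  case (Pair a b)
  define c where "c = m * (k + 1)"
  have e: "m * (n' + k + 1 + 1) = m * (n' + 1) + c" by (simp add: c_def algebra_simps)
  show ?thesis
    using d v m unfolding Pair inner_diag_simp is_mdiag_iff[OF m] e c_def[symmetric]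
    by auto
qed

text \<open>\<open>outer_diag v c\<close> makes room for \<open>c\<close> new vertices on the side \<open>(v, v + 1)\<close>, and \<open>inner_diag v\<close>
  glues a second polygon there.\<close>

definition join :: "nat \<Rightarrow> nat \<Rightarrow> (nat \<times> nat) set \<Rightarrow> (nat \<times> nat) set \<Rightarrow> (nat \<times> nat) set" where
  "join v c A B = insert (v, v + 1 + c) (outer_diag v c ` A \<union> inner_diag v ` B)"

lemma not_mdiag_side: "\<not> is_mdiag n m (v, v + 1)"
  by (auto simp: is_mdiag_def)

lemma not_mdiag_base: "0 < m \<Longrightarrow> \<not> is_mdiag n m (0, m * (n + 1) + 1)"
  by (subst is_mdiag_iff) auto

text \<open>Widened vertices skip \<open>v + 1\<close> to \<open>v + m * (k + 1)\<close>. A widened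
  chord with both ends in the inner polygon could therefore only come from the side
  \<open>(v, v + 1)\<close>, which is no diagonal.\<close>

lemma join_disjoint:
  assumes "0 < m"
  shows "is_mdiag k m d \<Longrightarrow> is_mdiag n' m e \<Longrightarrow> inner_diag v d \<noteq> outer_diag v (m * (k + 1)) e"
    and "is_mdiag k m d \<Longrightarrow> inner_diag v d \<noteq> (v, v + 1 + m * (k + 1))"
    and "is_mdiag n' m e \<Longrightarrow> outer_diag v (m * (k + 1)) e \<noteq> (v, v + 1 + m * (k + 1))"
  using assms by (cases d; cases e; auto simp: widen_def is_mdiag_iff split: if_splits)+

lemma join_mem:
  assumes "noncrossing_mdiags n' m A" "noncrossing_mdiags k m B" "0 < m"
  shows "is_mdiag k m d \<Longrightarrow> inner_diag v d \<in> join v (m * (k + 1)) A B \<longleftrightarrow> d \<in> B"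
    and "is_mdiag n' m e \<Longrightarrow> outer_diag v (m * (k + 1)) e \<in> join v (m * (k + 1)) A B \<longleftrightarrow> e \<in> A"
proof -
  note i = inj_image_mem_iff[OF inj_inner_diag] inj_image_mem_iff[OF inj_outer_diag]
  have A: "\<forall>e\<in>A. is_mdiag n' m e" and B: "\<forall>e\<in>B. is_mdiag k m e"
    using assms by (auto simp: noncrossing_mdiags_def)
  show "inner_diag v d \<in> join v (m * (k + 1)) A B \<longleftrightarrow> d \<in> B" if "is_mdiag k m d"
  proof -
    have "inner_diag v d \<notin> outer_diag v (m * (k + 1)) ` A"
      using join_disjoint(1)[OF assms(3) that] A by blast
    moreover have "inner_diag v d \<noteq> (v, v + 1 + m * (k + 1))"
      using join_disjoint(2)[OF assms(3) that] .
    ultimately show ?thesis unfolding join_def using i(1) by blast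
  qed
  show "outer_diag v (m * (k + 1)) e \<in> join v (m * (k + 1)) A B \<longleftrightarrow> e \<in> A" if "is_mdiag n' m e"
  proof -
    have "outer_diag v (m * (k + 1)) e \<notin> inner_diag v ` B"
      using join_disjoint(1)[OF assms(3) _ that] B by (metis imageE)
    moreover have "outer_diag v (m * (k + 1)) e \<noteq> (v, v + 1 + m * (k + 1))"
      using join_disjoint(3)[OF assms(3) that] .
    ultimately show ?thesis unfolding join_def using i(2) by blast
  qed
qed

lemma is_mdiag_join:
  assumes m: "0 < m" and v: "v \<le> m * (n' + 1)"
  shows "is_mdiag k m d \<Longrightarrow> is_mdiag (n' + k + 1) m (inner_diag v d)"
    and "is_mdiag n' m e \<Longrightarrow> is_mdiag (n' + k + 1) m (outer_diag v (m * (k + 1)) e)"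
    and "is_mdiag (n' + k + 1) m (v, v + 1 + m * (k + 1))"
proof -
  show "is_mdiag (n' + k + 1) m (inner_diag v d)" if "is_mdiag k m d"
  proof -
    have "d \<noteq> (0, m * (k + 1) + 1)" using not_mdiag_base[OF m] that by blast
    moreover have "snd d \<le> m * (k + 1) + 1"
      using that by (cases d) (simp add: is_mdiag_def nverts_def)
    ultimately show ?thesis using is_mdiag_inner_diag[OF m v] that by simp
  qed
  show "is_mdiag (n' + k + 1) m (outer_diag v (m * (k + 1)) e)" if "is_mdiag n' m e"
  proof -
    have "e \<noteq> (v, v + 1)" using not_mdiag_side that by blast
    moreover have "fst e < snd e"
      using that by (cases e) (simp add: is_mdiag_def)
    ultimately show ?thesis using is_mdiag_outer_diag[OF m v] that by simp
  qed
  have "m * (n' + k + 1 + 1) = m * (n' + 1) + m * (k + 1)" by (simp add: algebra_simps)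
  moreover have "0 < m * (k + 1)" "m \<le> m * (n' + 1)" using m by simp_all
  ultimately show "is_mdiag (n' + k + 1) m (v, v + 1 + m * (k + 1))"
    unfolding is_mdiag_iff[OF m] using v m by simp
qed

text \<open>Inner chords have both ends in the interval from \<open>v\<close> to
  \<open>v + 1 + m * (k + 1)\<close>, and no end of a widened chord lies strictly inside that
  interval.\<close>

lemma not_crossing_join:
  shows "is_mdiag k m d \<Longrightarrow> is_mdiag n' m e \<Longrightarrow>
      \<not> crossing (inner_diag v d) (outer_diag v (m * (k + 1)) e)"
    and "is_mdiag k m d \<Longrightarrow> \<not> crossing (inner_diag v d) (v, v + 1 + m * (k + 1))"
    and "is_mdiag n' m e \<Longrightarrow> \<not> crossing (outer_diag v (m * (k + 1)) e) (v, v + 1 + m * (k + 1))"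
  by (cases d; cases e; auto simp: crossing_def widen_def is_mdiag_def nverts_def split: if_splits)+

lemma noncrossing_join:
  assumes m: "0 < m" and v: "v \<le> m * (n' + 1)"
    and A: "noncrossing_mdiags n' m A" and B: "noncrossing_mdiags k m B"
  shows "noncrossing_mdiags (n' + k + 1) m (join v (m * (k + 1)) A B)"
proof -
  have Am: "is_mdiag n' m e" if "e \<in> A" for e using A that by (simp add: noncrossing_mdiags_def)
  have Bm: "is_mdiag k m e" if "e \<in> B" for e using B that by (simp add: noncrossing_mdiags_def)
  have Ac: "\<not> crossing d e" if "d \<in> A" "e \<in> A" for d e
    using A that by (simp add: noncrossing_mdiags_def)
  have Bc: "\<not> crossing d e" if "d \<in> B" "e \<in> B" for d e
    using B that by (simp add: noncrossing_mdiags_def)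
  define s where "s = (v, v + 1 + m * (k + 1))"
  define Out where "Out = outer_diag v (m * (k + 1)) ` A"
  define Inn where "Inn = inner_diag v ` B"
  have 0: "is_mdiag (n' + k + 1) m d" if "d \<in> insert s (Out \<union> Inn)" for d
    using is_mdiag_join(3)[OF m v, of k] that
    unfolding Out_def Inn_def s_def
    by (elim insertE UnE imageE) (simp_all only: is_mdiag_join[OF m v] Am Bm)
  have 1: "\<not> crossing s s" by (simp add: s_def crossing_def)
  have 2: "\<not> crossing d e" if "d \<in> Out" "e \<in> Out" for d e
    using that unfolding Out_def by (elim imageE) (simp only: crossing_outer_diag Ac not_False_eq_True)
  have 3: "\<not> crossing d e" if "d \<in> Inn" "e \<in> Inn" for d e
    using that unfolding Inn_def by (elim imageE) (simp only: crossing_inner_diag Bc not_False_eq_True)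
  have 4: "\<not> crossing d e" if "d \<in> Inn" "e \<in> Out" for d e
    using that not_crossing_join(1)[OF Bm Am] unfolding Inn_def Out_def by (elim imageE) simp
  have 5: "\<not> crossing d s" if "d \<in> Inn" for d
    using that not_crossing_join(2)[OF Bm] unfolding Inn_def s_def by (elim imageE) simp
  have 6: "\<not> crossing d s" if "d \<in> Out" for d
    using that not_crossing_join(3)[OF Am] unfolding Out_def s_def by (elim imageE) simp
  have "\<not> crossing d e" if "d \<in> insert s (Out \<union> Inn)" "e \<in> insert s (Out \<union> Inn)" for d e
    using that 1 2 3 4[of d e] 4[of e d] 5[of d] 5[of e] 6[of d] 6[of e] crossing_sym[of d e] by blast
  with 0 show ?thesis
    unfolding noncrossing_mdiags_def join_def s_def[symmetric] Out_def[symmetric] Inn_def[symmetric]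
    by blast
qed

lemma card_join:
  assumes m: "0 < m" and A: "noncrossing_mdiags n' m A" and B: "noncrossing_mdiags k m B"
  shows "card (join v (m * (k + 1)) A B) = card A + card B + 1"
proof -
  have Am: "is_mdiag n' m e" if "e \<in> A" for e using A that by (simp add: noncrossing_mdiags_def)
  have Bm: "is_mdiag k m e" if "e \<in> B" for e using B that by (simp add: noncrossing_mdiags_def)
  have fin: "finite A" "finite B" using A B by (simp_all add: finite_noncrossing_mdiags)
  have "outer_diag v (m * (k + 1)) ` A \<inter> inner_diag v ` B = {}"
  proof (intro equals0I, elim IntE imageE)
    fix x d e assume "x = outer_diag v (m * (k + 1)) e" "x = inner_diag v d" "e \<in> A" "d \<in> B"
    thus False using join_disjoint(1)[OF m Bm Am, of d e v] by metis
  qed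
  moreover have "(v, v + 1 + m * (k + 1)) \<notin> outer_diag v (m * (k + 1)) ` A \<union> inner_diag v ` B"
  proof (rule notI, elim UnE imageE)
    fix e assume "(v, v + 1 + m * (k + 1)) = outer_diag v (m * (k + 1)) e" "e \<in> A"
    thus False using join_disjoint(3)[OF m Am, of e v k] by metis
  next
    fix d assume "(v, v + 1 + m * (k + 1)) = inner_diag v d" "d \<in> B"
    thus False using join_disjoint(2)[OF m Bm, of d v] by metis
  qed
  ultimately show ?thesis
    using fin unfolding join_def
    by (simp add: card_Un_disjoint card_image inj_on_subset[OF inj_outer_diag] inj_on_subset[OF inj_inner_diag])
qed

text \<open>The converse of gluing: a diagonal that does not cross the cut lies on one side of it,
  and undoing the shift or the widening gives a diagonal of the smaller polygon there.\<close>

lemma join_decompose: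
  assumes m: "0 < m" and v: "v \<le> m * (n' + 1)"
    and D: "noncrossing_mdiags (n' + k + 1) m D" and s: "(v, v + 1 + m * (k + 1)) \<in> D"
  obtains A B where "noncrossing_mdiags n' m A" "noncrossing_mdiags k m B"
    "D = join v (m * (k + 1)) A B"
proof -
  define c where "c = m * (k + 1)"
  define A where "A = {e. is_mdiag n' m e \<and> outer_diag v c e \<in> D}"
  define B where "B = {e. is_mdiag k m e \<and> inner_diag v e \<in> D}"
  have Dm: "is_mdiag (n' + k + 1) m d" and Dc: "e \<in> D \<Longrightarrow> \<not> crossing d e" if "d \<in> D" for d e
    using D that by (auto simp: noncrossing_mdiags_def)
  have "noncrossing_mdiags n' m A" "noncrossing_mdiags k m B"
    using Dc unfolding noncrossing_mdiags_def A_def B_def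
    by (metis (no_types, lifting) crossing_outer_diag crossing_inner_diag mem_Collect_eq)+
  moreover have "D \<subseteq> join v c A B"
  proof
    fix d assume d: "d \<in> D"
    obtain a b where ab: "d = (a, b)" by (cases d)
    have lt: "a < b" using Dm[OF d] by (simp add: ab is_mdiag_def)
    have nc: "\<not> crossing (a, b) (v, v + 1 + c)" using Dc[OF d s] by (simp add: ab c_def)
    consider "d = (v, v + 1 + c)" | "d \<noteq> (v, v + 1 + c)" "v \<le> a" "b \<le> v + 1 + c"
      | "d \<noteq> (v, v + 1 + c)" "a < v \<or> v + 1 + c < b" by fastforce
    thus "d \<in> join v c A B"
    proof cases
      case 2
      hence e: "d = inner_diag v (a - v, b - v)" using lt by (simp add: ab)
      have "(a - v, b - v) \<noteq> (0, m * (k + 1) + 1)" "snd (a - v, b - v) \<le> m * (k + 1) + 1"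
        using 2 lt unfolding ab c_def prod.inject snd_conv by linarith+
      hence "is_mdiag k m (a - v, b - v)"
        using Dm[OF d] is_mdiag_inner_diag[OF m v, of "(a - v, b - v)" k] unfolding e[symmetric]
        by simp
      hence "(a - v, b - v) \<in> B" using d e by (simp add: B_def)
      thus ?thesis unfolding join_def using e by blast
    next
      case 3
      \<comment> \<open>\<open>w\<close> closes the gap again; it inverts \<open>widen v c\<close>
        on the vertices outside the gap.\<close>
      define w where "w x = (if x \<le> v then x else x - c)" for x
      have "(a \<le> v \<or> v + 1 + c \<le> a) \<and> (b \<le> v \<or> v + 1 + c \<le> b)"
        using nc 3 lt by (auto simp: crossing_def)
      hence e: "d = outer_diag v c (w a, w b)"
        using lt by (auto simp: ab widen_def w_def)
      hence "widen v c (w a) < widen v c (w b)" using lt by (simp add: ab)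
      hence "w a < w b" by simp
      moreover have "(w a, w b) \<noteq> (v, v + 1)" using 3(1) unfolding e by (auto simp: widen_def)
      ultimately have "is_mdiag n' m (w a, w b)"
        using Dm[OF d] is_mdiag_outer_diag[OF m v, of "(w a, w b)" k] unfolding e c_def
        by simp
      hence "(w a, w b) \<in> A" using d e by (simp add: A_def)
      thus ?thesis unfolding join_def using e by blast
    qed (simp add: join_def)
  qed
  moreover have "join v c A B \<subseteq> D"
    using s by (auto simp: join_def A_def B_def c_def)
  ultimately show ?thesis using that unfolding c_def by blast
qed

text \<open>Cutting along any one diagonal leaves polygons of parameters \<open>n'\<close> and
  \<open>k\<close> with \<open>n' + k + 1 = n\<close>, so the bound follows by strong induction. It
  makes dissections exactly the sets of maximal size.\<close>

lemma card_noncrossing_mdiags_le: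
  assumes "0 < m" "noncrossing_mdiags n m D"
  shows "card D \<le> n"
  using assms(2)
proof (induction n arbitrary: D rule: less_induct)
  case (less n)
  show ?case
  proof (cases "D = {}")
    case False
    then obtain a b where ab: "(a, b) \<in> D" by fastforce
    with less.prems have "is_mdiag n m (a, b)" by (simp add: noncrossing_mdiags_def)
    then obtain k where k: "k < n" "b = a + 1 + m * (k + 1)" "a \<le> m * (n - k)"
      by (rule is_mdiag_length[OF assms(1)])
    define n' where "n' = n - k - 1"
    have n: "n = n' + k + 1" and a: "a \<le> m * (n' + 1)" using k by (simp_all add: n'_def Suc_diff_Suc)
    obtain A B where *: "noncrossing_mdiags n' m A" "noncrossing_mdiags k m B" "D = join a (m * (k + 1)) A B"
      by (rule join_decompose[OF assms(1) a less.prems[unfolded n] ab[unfolded k(2)]])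
    have "card D = card A + card B + 1" using card_join[OF assms(1) *(1,2)] *(3) by simp
    moreover have "card A \<le> n'" "card B \<le> k" using less.IH * n by auto
    ultimately show ?thesis using n by simp
  qed simp
qed

lemma bij_betw_join:
  assumes m: "0 < m" and v: "v \<le> m * (n' + 1)"
  shows "bij_betw (\<lambda>(A, B). join v (m * (k + 1)) A B) (dissections n' m \<times> dissections k m)
    {D \<in> dissections (n' + k + 1) m. (v, v + 1 + m * (k + 1)) \<in> D}"
proof (intro bij_betw_imageI inj_onI)
  fix p q
  assume pq: "p \<in> dissections n' m \<times> dissections k m" "q \<in> dissections n' m \<times> dissections k m"
    "(\<lambda>(A, B). join v (m * (k + 1)) A B) p = (\<lambda>(A, B). join v (m * (k + 1)) A B) q"
  obtain A B A' B' where e: "p = (A, B)" "q = (A', B')" by fastforce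
  have nc: "noncrossing_mdiags n' m A" "noncrossing_mdiags k m B"
    "noncrossing_mdiags n' m A'" "noncrossing_mdiags k m B'"
    using pq(1,2) e by (auto simp: dissections_eq)
  have eq: "join v (m * (k + 1)) A B = join v (m * (k + 1)) A' B'" using pq(3) e by simp
  have "d \<in> A \<longleftrightarrow> d \<in> A'" if "is_mdiag n' m d" for d
    using join_mem(2)[OF nc(1,2) m that, of v] join_mem(2)[OF nc(3,4) m that, of v] eq by simp
  moreover have "d \<in> B \<longleftrightarrow> d \<in> B'" if "is_mdiag k m d" for d
    using join_mem(1)[OF nc(1,2) m that, of v] join_mem(1)[OF nc(3,4) m that, of v] eq by simp
  ultimately show "p = q" using nc e unfolding noncrossing_mdiags_def by auto
next
  have f1: "join v (m * (k + 1)) A B \<in> {D \<in> dissections (n' + k + 1) m. (v, v + 1 + m * (k + 1)) \<in> D}"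
    if "A \<in> dissections n' m" "B \<in> dissections k m" for A B
  proof -
    have nc: "noncrossing_mdiags n' m A" "noncrossing_mdiags k m B" "card A = n'" "card B = k"
      using that by (auto simp: dissections_eq)
    thus ?thesis unfolding dissections_eq mem_Collect_eq
      using noncrossing_join[OF m v nc(1,2)] card_join[OF m nc(1,2)] by (simp add: join_def)
  qed
  have f2: "\<exists>A \<in> dissections n' m. \<exists>B \<in> dissections k m. D = join v (m * (k + 1)) A B"
    if "D \<in> dissections (n' + k + 1) m" "(v, v + 1 + m * (k + 1)) \<in> D" for D
  proof -
    note s = that(2)
    have D: "noncrossing_mdiags (n' + k + 1) m D" "card D = n' + k + 1"
      using that by (auto simp: dissections_eq)
    obtain A B where *: "noncrossing_mdiags n' m A" "noncrossing_mdiags k m B" "D = join v (m * (k + 1)) A B"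
      by (rule join_decompose[OF m v D(1) s])
    have "card D = card A + card B + 1" using card_join[OF m *(1,2)] *(3) by simp
    moreover have "card A \<le> n'" "card B \<le> k" using card_noncrossing_mdiags_le[OF m] * by auto
    \<comment> \<open>The two upper bounds add up to the exact total, so both are attained and each
      piece is fully dissected.\<close>
    ultimately have "card A = n'" "card B = k" using D by auto
    thus ?thesis using * by (auto simp: dissections_eq)
  qed
  show "(\<lambda>(A, B). join v (m * (k + 1)) A B) ` (dissections n' m \<times> dissections k m) =
    {D \<in> dissections (n' + k + 1) m. (v, v + 1 + m * (k + 1)) \<in> D}"
  proof (intro set_eqI iffI)
    fix D assume "D \<in> (\<lambda>(A, B). join v (m * (k + 1)) A B) ` (dissections n' m \<times> dissections k m)"
    thus "D \<in> {D \<in> dissections (n' + k + 1) m. (v, v + 1 + m * (k + 1)) \<in> D}"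
      using f1 by (elim imageE SigmaE) (simp only: prod.case)
  next
    fix D assume "D \<in> {D \<in> dissections (n' + k + 1) m. (v, v + 1 + m * (k + 1)) \<in> D}"
    then obtain A B where "A \<in> dissections n' m" "B \<in> dissections k m" "D = join v (m * (k + 1)) A B"
      using f2 by blast
    thus "D \<in> (\<lambda>(A, B). join v (m * (k + 1)) A B) ` (dissections n' m \<times> dissections k m)"
      by (intro image_eqI[of _ _ "(A, B)"]) simp_all
  qed
qed

section \<open>The largest left endpoint of a dissection\<close>

lemma dissections_0: "dissections 0 m = {{}}"
  by (auto simp: dissections_def)

text \<open>Inserting 0 gives the empty dissection the value 0, which matches the statistic of the
  single sequence \<open>[0]\<close> when \<open>n = 0\<close>.\<close>

definition max_left :: "(nat \<times> nat) set \<Rightarrow> nat" where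
  "max_left D = Max (insert 0 (fst ` D))"

lemma max_left_le_iff: "finite D \<Longrightarrow> max_left D \<le> v \<longleftrightarrow> (\<forall>d\<in>D. fst d \<le> v)"
  by (simp add: max_left_def)

lemma max_left_eqI:
  assumes "finite D" "\<And>d. d \<in> D \<Longrightarrow> fst d \<le> v" "(v, w) \<in> D"
  shows "max_left D = v"
  unfolding max_left_def using assms by (intro Max_eqI) (auto intro: image_eqI[of v fst "(v, w)"])

lemma max_left_mem:
  assumes "finite D" "D \<noteq> {}"
  shows "\<exists>w. (max_left D, w) \<in> D"
proof -
  have "Max (fst ` D) \<in> fst ` D" using assms by (intro Max_in) auto
  moreover have "max_left D = Max (fst ` D)" unfolding max_left_def using assms by simp
  ultimately show ?thesis by force
qed

lemma finite_dissection: "D \<in> dissections n m \<Longrightarrow> finite D"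
  by (simp add: dissections_def)

lemma max_left_bound:
  assumes "0 < m" "D \<in> dissections n m"
  shows "max_left D \<le> m * n"
proof -
  have "fst d \<le> m * n" if "d \<in> D" for d
  proof -
    obtain a b where "d = (a, b)" by (cases d)
    with that assms have "is_mdiag n m (a, b)" by (auto simp: dissections_def)
    from is_mdiag_length[OF assms(1) this] obtain k where k: "k < n" "b = a + 1 + m * (k + 1)"
      by blast
    have "b \<le> m * (n + 1) + 1" using \<open>is_mdiag n m (a, b)\<close> unfolding is_mdiag_iff[OF assms(1)] by simp
    with k have "a \<le> m * n" by (simp add: algebra_simps)
    with \<open>d = (a, b)\<close> show ?thesis by simp
  qed
  thus ?thesis using assms by (simp add: max_left_le_iff finite_dissection)
qed

lemma fst_outer_diag_le_iff: "fst (outer_diag v c d) \<le> v \<longleftrightarrow> fst d \<le> v"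
  by (cases d) (auto simp: widen_def)

text \<open>A shortest diagonal at the largest left endpoint cuts off an \<open>(m+2)\<close>-gon; collapsing it
  leaves a dissection with one diagonal fewer.\<close>

lemma card_max_left_Suc:
  assumes m: "0 < m" and v: "v \<le> m * (n + 1)"
  shows "card {D \<in> dissections (n + 1) m. max_left D = v} = card {A \<in> dissections n m. max_left A \<le> v}"
proof -
  define J where "J A = join v (m * (0 + 1)) A {}" for A
  have bij: "bij_betw J (dissections n m) {D \<in> dissections (n + 0 + 1) m. (v, v + 1 + m * (0 + 1)) \<in> D}"
  proof -
    have "bij_betw (\<lambda>A. (A, {})) (dissections n m) (dissections n m \<times> dissections 0 m)"
      by (auto simp: dissections_0 bij_betw_def inj_on_def)
    from bij_betw_trans[OF this bij_betw_join[OF m v, of 0]]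
    show ?thesis by (simp add: comp_def J_def[abs_def])
  qed
  \<comment> \<open>The new diagonal starts at \<open>v\<close>, and widening does not move any left
    endpoint across \<open>v\<close>; so the maximum is \<open>v\<close> exactly when no old left
    endpoint exceeds \<open>v\<close>.\<close>
  have left: "max_left (J A) = v \<longleftrightarrow> max_left A \<le> v" if A: "A \<in> dissections n m" for A
  proof
    have fin: "finite (J A)" using finite_dissection[OF A] by (simp add: J_def join_def)
    have le: "(\<forall>d\<in>J A. fst d \<le> v) \<longleftrightarrow> (\<forall>d\<in>A. fst d \<le> v)"
      unfolding J_def join_def by (simp add: fst_outer_diag_le_iff)
    show "max_left A \<le> v" if "max_left (J A) = v"
      using that le fin finite_dissection[OF A] max_left_le_iff by (metis order_refl)
    show "max_left (J A) = v" if "max_left A \<le> v"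
      using that le fin finite_dissection[OF A] max_left_le_iff
      by (intro max_left_eqI[of _ _ "v + 1 + m * (0 + 1)"]) (auto simp: J_def join_def)
  qed
  have "J ` {A \<in> dissections n m. max_left A \<le> v} = {D \<in> dissections (n + 1) m. max_left D = v}"
  proof (intro equalityI subsetI)
    fix D assume "D \<in> J ` {A \<in> dissections n m. max_left A \<le> v}"
    then obtain A where A: "A \<in> dissections n m" "max_left A \<le> v" "D = J A" by blast
    moreover have "J A \<in> dissections (n + 1) m" using bij_betwE[OF bij] A(1) by simp
    ultimately show "D \<in> {D \<in> dissections (n + 1) m. max_left D = v}"
      using left by simp
  next
    fix D assume "D \<in> {D \<in> dissections (n + 1) m. max_left D = v}"
    hence D: "D \<in> dissections (n + 1) m" and ml: "max_left D = v" by auto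
    have fin: "finite D" by (rule finite_dissection[OF D])
    have "D \<noteq> {}" using D by (auto simp: dissections_def)
    hence ex: "\<exists>w. (v, w) \<in> D" using max_left_mem[OF fin] ml by simp
    define w where "w = (LEAST w. (v, w) \<in> D)"
    have w: "(v, w) \<in> D" unfolding w_def using ex by (rule LeastI_ex)
    have wmin: "w \<le> w'" if "(v, w') \<in> D" for w' unfolding w_def using that by (rule Least_le)
    have "is_mdiag (n + 1) m (v, w)" using D w by (simp add: dissections_def)
    then obtain k where k: "k < n + 1" "w = v + 1 + m * (k + 1)" "v \<le> m * (n + 1 - k)"
      by (rule is_mdiag_length[OF m])
    define n' where "n' = n - k"
    have n: "n + 1 = n' + k + 1" and v': "v \<le> m * (n' + 1)" using k by (auto simp: n'_def Suc_diff_le)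
    have "D \<in> (\<lambda>(A, B). join v (m * (k + 1)) A B) ` (dissections n' m \<times> dissections k m)"
      unfolding bij_betw_imp_surj_on[OF bij_betw_join[OF m v', of k]]
      using D[unfolded n] w[unfolded k(2)] by simp
    then obtain A B where AB: "A \<in> dissections n' m" "B \<in> dissections k m" "D = join v (m * (k + 1)) A B"
      by auto
    \<comment> \<open>A diagonal inside the cut-off piece starts at \<open>v\<close> or later, hence
      at \<open>v\<close> by maximality, and would then be shorter than the shortest diagonal
      \<open>(v, w)\<close>.\<close>
    have "B = {}"
    proof (rule ccontr)
      assume "B \<noteq> {}"
      then obtain a b where ab: "(a, b) \<in> B" by fastforce
      hence "inner_diag v (a, b) \<in> D" using AB(3) unfolding join_def by blast
      hence mem: "(v + a, v + b) \<in> D" by simp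
      hence "a = 0" using ml max_left_le_iff[OF fin, of v] by auto
      hence "w \<le> v + b" using wmin[of "v + b"] mem by simp
      moreover have "is_mdiag k m (a, b)" using ab AB(2) by (auto simp: dissections_def)
      ultimately show False using m \<open>a = 0\<close> unfolding is_mdiag_iff[OF m] k by simp
    qed
    hence "k = 0" using AB by (auto simp: dissections_def)
    hence "D = J A" "A \<in> dissections n m" using AB \<open>B = {}\<close> n by (auto simp: J_def)
    thus "D \<in> J ` {A \<in> dissections n m. max_left A \<le> v}" using left ml by auto
  qed
  moreover have "inj_on J {A \<in> dissections n m. max_left A \<le> v}"
    using bij_betw_imp_inj_on[OF bij] by (rule inj_on_subset) auto
  hence "card (J ` {A \<in> dissections n m. max_left A \<le> v}) = card {A \<in> dissections n m. max_left A \<le> v}"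
    by (rule card_image)
  ultimately show ?thesis by simp
qed

section \<open>Counting\<close>

text \<open>Bijections chosen separately on the fibres are glued; the result carries the statistic
  \<open>f\<close> to \<open>g\<close>.\<close>

lemma bij_betw_Union_fibres:
  assumes fin: "finite A" "finite B"
    and card: "\<And>k. card {a \<in> A. f a = k} = card {b \<in> B. g b = k}"
  obtains h where "bij_betw h A B" "\<And>a. a \<in> A \<Longrightarrow> g (h a) = f a"
proof -
  have "\<exists>h. bij_betw h {a \<in> A. f a = k} {b \<in> B. g b = k}" for k
    using fin card by (intro finite_same_card_bij) auto
  then obtain h where h: "\<And>k. bij_betw (h k) {a \<in> A. f a = k} {b \<in> B. g b = k}" by metis
  have mem: "h (f a) a \<in> B \<and> g (h (f a) a) = f a" if "a \<in> A" for a
    using bij_betwE[OF h[of "f a"]] that by blast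
  have "bij_betw (\<lambda>a. h (f a) a) A B"
    unfolding bij_betw_def
  proof (intro conjI inj_onI equalityI subsetI)
    fix a a' assume *: "a \<in> A" "a' \<in> A" "h (f a) a = h (f a') a'"
    hence "f a = f a'" using mem by metis
    thus "a = a'" using * bij_betw_imp_inj_on[OF h[of "f a"]] by (auto dest: inj_onD)
  next
    fix b assume "b \<in> B"
    hence "b \<in> h (g b) ` {a \<in> A. f a = g b}"
      using bij_betw_imp_surj_on[OF h[of "g b"]] by simp
    then obtain a where "a \<in> A" "f a = g b" "b = h (g b) a" by blast
    thus "b \<in> (\<lambda>a. h (f a) a) ` A" by (intro image_eqI[of _ _ a]) simp_all
  qed (use mem in auto)
  thus ?thesis using that mem by blast
qed

text \<open>Inclusion-exclusion in the form of an induction from large sets down to small ones: the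
  count for \<open>I \<subseteq> f a\<close> is the exact count for \<open>I\<close> plus the exact
  counts for the strictly larger sets, which agree already.\<close>

lemma card_fibres_eq_of_superset_counts:
  assumes fin: "finite A" "finite B" "finite U"
    and sub: "\<And>a. a \<in> A \<Longrightarrow> f a \<subseteq> U" "\<And>b. b \<in> B \<Longrightarrow> g b \<subseteq> U"
    and card: "\<And>I. I \<subseteq> U \<Longrightarrow> card {a \<in> A. I \<subseteq> f a} = card {b \<in> B. I \<subseteq> g b}"
  shows "card {a \<in> A. f a = I} = card {b \<in> B. g b = I}"
proof (cases "I \<subseteq> U")
  case True
  thus ?thesis
  proof (induction "card (U - I)" arbitrary: I rule: less_induct)
    case less
    define P where "P = {J. I \<subset> J \<and> J \<subseteq> U}"
    have P: "finite P" unfolding P_def using fin by (auto intro: finite_subset[of _ "Pow U"])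
    have split: "card {x \<in> X. I \<subseteq> F x} = card {x \<in> X. F x = I} + (\<Sum>J\<in>P. card {x \<in> X. F x = J})"
      if X: "finite X" "\<And>x. x \<in> X \<Longrightarrow> F x \<subseteq> U" for X :: "'z set" and F :: "'z \<Rightarrow> _"
    proof -
      have "{x \<in> X. I \<subseteq> F x} = {x \<in> X. F x = I} \<union> (\<Union>J\<in>P. {x \<in> X. F x = J})"
        using X by (auto simp: P_def)
      moreover have "card (\<Union>J\<in>P. {x \<in> X. F x = J}) = (\<Sum>J\<in>P. card {x \<in> X. F x = J})"
        using X P by (intro card_UN_disjoint) auto
      moreover have "{x \<in> X. F x = I} \<inter> (\<Union>J\<in>P. {x \<in> X. F x = J}) = {}"
        by (auto simp: P_def)
      ultimately show ?thesis using X P by (simp add: card_Un_disjoint)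
    qed
    have "card {a \<in> A. f a = J} = card {b \<in> B. g b = J}" if "J \<in> P" for J
    proof (rule less.hyps)
      show "card (U - J) < card (U - I)"
        using that fin(3) by (intro psubset_card_mono) (auto simp: P_def)
    qed (use that in \<open>auto simp: P_def\<close>)
    hence "(\<Sum>J\<in>P. card {a \<in> A. f a = J}) = (\<Sum>J\<in>P. card {b \<in> B. g b = J})" by simp
    thus ?case
      using split[of A f, OF fin(1) sub(1)] split[of B g, OF fin(2) sub(2)] card[OF less.prems]
      by linarith
  qed
next
  case False
  hence "{a \<in> A. f a = I} = {}" "{b \<in> B. g b = I} = {}" using sub by auto
  thus ?thesis by (simp only: card.empty)
qed

section \<open>Ballot sequences and their recursion\<close>

definition ballot_seqs :: "nat \<Rightarrow> nat \<Rightarrow> nat list set" where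
  "ballot_seqs n m = {b. length b = n + 1 \<and> b ! 0 = 0 \<and> (\<forall>i<n. b ! Suc i \<le> b ! i + m)}"

lemma ballot_seqs_bound:
  assumes "b \<in> ballot_seqs n m" "i \<le> n"
  shows "b ! i \<le> m * i"
  using assms(2)
proof (induction i)
  case 0
  thus ?case using assms by (simp add: ballot_seqs_def)
next
  case (Suc i)
  moreover have "b ! Suc i \<le> b ! i + m" using assms(1) Suc.prems by (simp add: ballot_seqs_def)
  ultimately show ?case by simp
qed

lemma last_ballot_seq: "b \<in> ballot_seqs n m \<Longrightarrow> last b = b ! n"
  by (cases "b = []") (auto simp: ballot_seqs_def last_conv_nth)

lemma last_ballot_seq_le: "b \<in> ballot_seqs n m \<Longrightarrow> last b \<le> m * n"
  using ballot_seqs_bound[of b n m n] by (simp add: last_ballot_seq)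

lemma finite_ballot_seqs: "finite (ballot_seqs n m)"
proof (rule finite_subset)
  show "ballot_seqs n m \<subseteq> {b. set b \<subseteq> {..m * n} \<and> length b = n + 1}"
  proof safe
    fix b x assume b: "b \<in> ballot_seqs n m" "x \<in> set b"
    then obtain i where "i < length b" "b ! i = x" by (auto simp: in_set_conv_nth)
    moreover have "length b = n + 1" using b by (simp add: ballot_seqs_def)
    ultimately have "i \<le> n" "x \<le> m * i" using ballot_seqs_bound[OF b(1)] by auto
    thus "x \<le> m * n" using mult_le_mono2 order_trans by blast
  qed (simp add: ballot_seqs_def)
qed (simp add: finite_lists_length_eq)

lemma ballot_seqs_0: "ballot_seqs 0 m = {[0]}"
  by (auto simp: ballot_seqs_def length_Suc_conv)

lemma snoc_mem_ballot_seqs_iff: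
  assumes "length b = n + 1"
  shows "b @ [c] \<in> ballot_seqs (n + 1) m \<longleftrightarrow> b \<in> ballot_seqs n m \<and> c \<le> last b + m"
proof -
  have "last b = b ! n" using assms by (cases "b = []") (auto simp: last_conv_nth)
  moreover have "(\<forall>i<n + 1. (b @ [c]) ! Suc i \<le> (b @ [c]) ! i + m) \<longleftrightarrow>
      (\<forall>i<n. b ! Suc i \<le> b ! i + m) \<and> c \<le> b ! n + m"
    unfolding Suc_eq_plus1[symmetric] All_less_Suc using assms by (auto simp: nth_append)
  ultimately show ?thesis using assms by (simp add: ballot_seqs_def nth_append)
qed

text \<open>The counterpart of \<open>card_max_left_Suc\<close>: the distance of the last entry from
  its maximal value \<open>m * n\<close> obeys the recursion of the largest left endpoint.\<close>

lemma card_last_Suc: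
  assumes v: "v \<le> m * (n + 1)"
  shows "card {b \<in> ballot_seqs (n + 1) m. m * (n + 1) - last b = v} =
    card {b \<in> ballot_seqs n m. m * n - last b \<le> v}"
proof -
  define c where "c = m * (n + 1) - v"
  \<comment> \<open>Both truncated subtractions are genuine here, since
    \<open>last b \<le> m * n\<close> and \<open>v \<le> m * (n + 1)\<close>.\<close>
  have c: "c \<le> last b + m \<longleftrightarrow> m * n - last b \<le> v" if "b \<in> ballot_seqs n m" for b
    using last_ballot_seq_le[OF that] v by (auto simp: c_def)
  have "{b \<in> ballot_seqs (n + 1) m. m * (n + 1) - last b = v} =
    (\<lambda>b. b @ [c]) ` {b \<in> ballot_seqs n m. m * n - last b \<le> v}"
  proof (intro equalityI subsetI)
    fix b assume b: "b \<in> {b \<in> ballot_seqs (n + 1) m. m * (n + 1) - last b = v}"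
    hence "length b = Suc (n + 1)" by (simp add: ballot_seqs_def)
    then obtain b' x where b': "b = b' @ [x]" "length b' = n + 1"
      by (metis length_Suc_conv_rev)
    have "x = c" using b last_ballot_seq_le[of b "n + 1" m] by (auto simp: c_def b')
    thus "b \<in> (\<lambda>b. b @ [c]) ` {b \<in> ballot_seqs n m. m * n - last b \<le> v}"
      using b snoc_mem_ballot_seqs_iff[OF b'(2)] c by (auto simp: b')
  next
    fix b assume "b \<in> (\<lambda>b. b @ [c]) ` {b \<in> ballot_seqs n m. m * n - last b \<le> v}"
    then obtain b' where b': "b = b' @ [c]" "b' \<in> ballot_seqs n m" "m * n - last b' \<le> v" by blast
    have "length b' = n + 1" using b' by (simp add: ballot_seqs_def)
    thus "b \<in> {b \<in> ballot_seqs (n + 1) m. m * (n + 1) - last b = v}"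
      using b' c snoc_mem_ballot_seqs_iff[of b' n c m] v by (auto simp: c_def)
  qed
  thus ?thesis by (simp add: card_image inj_on_def)
qed

text \<open>The recursion for \<open>n + 1\<close> needs the distribution of the statistic for
  \<open>n\<close>, so the statistic is carried through the induction. Only the equality of
  cardinalities is used afterwards; this bijection need not respect the snake.\<close>

lemma ex_bij_dissections_ballot_seqs:
  assumes m: "0 < m"
  shows "\<exists>h. bij_betw h (dissections n m) (ballot_seqs n m) \<and>
    (\<forall>D \<in> dissections n m. m * n - last (h D) = max_left D)"
proof (induction n)
  case 0
  show ?case by (auto simp: dissections_0 ballot_seqs_0 max_left_def bij_betw_def)
next
  case (Suc n)
  then obtain h where h: "bij_betw h (dissections n m) (ballot_seqs n m)"
    "\<And>D. D \<in> dissections n m \<Longrightarrow> m * n - last (h D) = max_left D" by blast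
  have "card {D \<in> dissections (n + 1) m. max_left D = v} =
    card {b \<in> ballot_seqs (n + 1) m. m * (n + 1) - last b = v}" for v
  proof (cases "v \<le> m * (n + 1)")
    case True
    have "bij_betw h {D \<in> dissections n m. max_left D \<le> v} {b \<in> ballot_seqs n m. m * n - last b \<le> v}"
      using h by (intro bij_betw_Collect) auto
    hence "card {D \<in> dissections n m. max_left D \<le> v} = card {b \<in> ballot_seqs n m. m * n - last b \<le> v}"
      by (rule bij_betw_same_card)
    thus ?thesis using card_max_left_Suc[OF m True] card_last_Suc[OF True] by simp
  next
    case False
    hence "{D \<in> dissections (n + 1) m. max_left D = v} = {}"
      "{b \<in> ballot_seqs (n + 1) m. m * (n + 1) - last b = v} = {}"
      using max_left_bound[OF m, of _ "n + 1"] by auto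
    thus ?thesis by (simp only: card.empty)
  qed
  from bij_betw_Union_fibres[OF finite_dissections finite_ballot_seqs this]
  obtain h' where "bij_betw h' (dissections (n + 1) m) (ballot_seqs (n + 1) m)"
    "\<And>D. D \<in> dissections (n + 1) m \<Longrightarrow> m * (n + 1) - last (h' D) = max_left D" by blast
  thus ?case by auto
qed

lemma card_dissections:
  assumes "0 < m"
  shows "card (dissections n m) = card (ballot_seqs n m)"
  using ex_bij_dissections_ballot_seqs[OF assms, of n] bij_betw_same_card by blast

text \<open>An entry 0 satisfies its upper bound whatever precedes it. Hence the sequence may be cut
  in front of that entry, and the two parts vary independently.\<close>

lemma card_ballot_seqs_zero:
  assumes n: "n = n' + k + 1" and I: "I \<subseteq> {1..k}"
  shows "card {b \<in> ballot_seqs n m. b ! (n' + 1) = 0 \<and> (\<forall>j\<in>I. b ! (n' + 1 + j) = 0)} =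
    card (ballot_seqs n' m) * card {b \<in> ballot_seqs k m. \<forall>j\<in>I. b ! j = 0}"
proof -
  have append: "b @ c \<in> ballot_seqs n m \<and> (b @ c) ! (n' + 1) = 0 \<longleftrightarrow>
      b \<in> ballot_seqs n' m \<and> c \<in> ballot_seqs k m"
    if l: "length b = n' + 1" "length c = k + 1" for b c
  proof -
    have "(\<forall>i<n. (b @ c) ! Suc i \<le> (b @ c) ! i + m) \<longleftrightarrow>
      (\<forall>i<n'. b ! Suc i \<le> b ! i + m) \<and> (\<forall>i<k. c ! Suc i \<le> c ! i + m)" if c: "c ! 0 = 0"
    proof (intro iffI conjI allI impI)
      fix i assume *: "\<forall>i<n. (b @ c) ! Suc i \<le> (b @ c) ! i + m"
      show "b ! Suc i \<le> b ! i + m" if "i < n'"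
        using *[rule_format, of i] that l n by (simp add: nth_append)
      show "c ! Suc i \<le> c ! i + m" if "i < k"
        using *[rule_format, of "n' + 1 + i"] that l n by (simp add: nth_append)
    next
      fix i assume *: "(\<forall>i<n'. b ! Suc i \<le> b ! i + m) \<and> (\<forall>i<k. c ! Suc i \<le> c ! i + m)" and "i < n"
      consider "i < n'" | "i = n'" | "i > n'" by linarith
      thus "(b @ c) ! Suc i \<le> (b @ c) ! i + m"
      proof cases
        case 3
        define j where "j = i - (n' + 1)"
        have "i = n' + 1 + j" "j < k" using 3 \<open>i < n\<close> n by (simp_all add: j_def)
        thus ?thesis using * l by (simp add: nth_append)
      qed (use * l c in \<open>simp_all add: nth_append\<close>)
    qed
    moreover have "(b @ c) ! (n' + 1) = c ! 0" "(b @ c) ! 0 = b ! 0"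
      using l by (simp_all add: nth_append)
    ultimately show ?thesis using l n by (auto simp: ballot_seqs_def)
  qed
  define Z where "Z = {b \<in> ballot_seqs k m. \<forall>j\<in>I. b ! j = 0}"
  have "bij_betw (\<lambda>(b, c). b @ c) (ballot_seqs n' m \<times> Z)
    {b \<in> ballot_seqs n m. b ! (n' + 1) = 0 \<and> (\<forall>j\<in>I. b ! (n' + 1 + j) = 0)}"
  proof (intro bij_betw_imageI inj_onI equalityI subsetI)
    fix p q assume "p \<in> ballot_seqs n' m \<times> Z" "q \<in> ballot_seqs n' m \<times> Z"
      "(\<lambda>(b, c). b @ c) p = (\<lambda>(b, c). b @ c) q"
    thus "p = q" by (cases p; cases q) (auto simp: ballot_seqs_def Z_def)
  next
    fix x assume "x \<in> (\<lambda>(b, c). b @ c) ` (ballot_seqs n' m \<times> Z)"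
    then obtain b c where *: "x = b @ c" "b \<in> ballot_seqs n' m" "c \<in> Z" by auto
    hence l: "length b = n' + 1" "length c = k + 1" by (auto simp: ballot_seqs_def Z_def)
    have "\<forall>j\<in>I. x ! (n' + 1 + j) = 0" using * l by (auto simp: nth_append Z_def)
    thus "x \<in> {b \<in> ballot_seqs n m. b ! (n' + 1) = 0 \<and> (\<forall>j\<in>I. b ! (n' + 1 + j) = 0)}"
      using append[OF l] * by (simp add: Z_def)
  next
    fix x assume x: "x \<in> {b \<in> ballot_seqs n m. b ! (n' + 1) = 0 \<and> (\<forall>j\<in>I. b ! (n' + 1 + j) = 0)}"
    define b c where "b = take (n' + 1) x" and "c = drop (n' + 1) x"
    have "length x = n + 1" using x by (simp add: ballot_seqs_def)
    hence l: "length b = n' + 1" "length c = k + 1" and xe: "x = b @ c"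
      using n by (simp_all add: b_def c_def)
    have "\<forall>j\<in>I. c ! j = 0" using x l by (auto simp: xe nth_append)
    hence "b \<in> ballot_seqs n' m" "c \<in> Z" using append[OF l] x by (auto simp: xe Z_def)
    thus "x \<in> (\<lambda>(b, c). b @ c) ` (ballot_seqs n' m \<times> Z)"
      unfolding xe by (intro image_eqI[of _ _ "(b, c)"]) auto
  qed
  from bij_betw_same_card[OF this] show ?thesis by (simp add: Z_def card_cartesian_product)
qed

section \<open>The snake\<close>

definition reflect_diag :: "nat \<Rightarrow> nat \<times> nat \<Rightarrow> nat \<times> nat" where
  "reflect_diag M d = (M - snd d, M - fst d)"

lemma is_mdiag_snd_le: "is_mdiag n m d \<Longrightarrow> fst d < snd d \<and> snd d \<le> m * (n + 1) + 1"
  by (cases d) (simp add: is_mdiag_def nverts_def)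

lemma is_mdiag_reflect:
  assumes m: "0 < m" and d: "is_mdiag n m d"
  shows "is_mdiag n m (reflect_diag (m * (n + 1) + 1) d)"
proof -
  obtain a b where ab: "d = (a, b)" by (cases d)
  define M where "M = m * (n + 1) + 1"
  have *: "a + 2 \<le> b" "b \<le> M" "b - a \<le> m * (n + 1)" "m dvd b - a - 1"
    using d unfolding ab is_mdiag_iff[OF m] M_def by auto
  hence "M - a - (M - b) = b - a" "M - b + 2 \<le> M - a" by auto
  thus ?thesis
    using * unfolding ab reflect_diag_def is_mdiag_iff[OF m] fst_conv snd_conv M_def[symmetric] by simp
qed

lemma reflect_reflect:
  "fst d \<le> M \<Longrightarrow> snd d \<le> M \<Longrightarrow> reflect_diag M (reflect_diag M d) = d"
  by (cases d) (simp add: reflect_diag_def)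

lemma reflect_reflect_mdiag:
  assumes "is_mdiag n m d"
  shows "reflect_diag (m * (n + 1) + 1) (reflect_diag (m * (n + 1) + 1) d) = d"
  using is_mdiag_snd_le[OF assms] by (intro reflect_reflect) auto

lemma crossing_reflect:
  assumes "is_mdiag n m d" "is_mdiag n m e"
  shows "crossing (reflect_diag (m * (n + 1) + 1) d) (reflect_diag (m * (n + 1) + 1) e) \<longleftrightarrow> crossing d e"
  using is_mdiag_snd_le[OF assms(1)] is_mdiag_snd_le[OF assms(2)]
  by (cases d; cases e) (auto simp: crossing_def reflect_diag_def)

lemma reflect_dissection:
  assumes m: "0 < m" and D: "D \<in> dissections n m"
  shows "reflect_diag (m * (n + 1) + 1) ` D \<in> dissections n m"
    and "reflect_diag (m * (n + 1) + 1) ` reflect_diag (m * (n + 1) + 1) ` D = D"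
proof -
  let ?r = "reflect_diag (m * (n + 1) + 1)"
  have md: "is_mdiag n m d" if "d \<in> D" for d using D that by (simp add: dissections_def)
  show rr: "?r ` ?r ` D = D"
  proof -
    have "?r (?r d) = d" if "d \<in> D" for d using reflect_reflect_mdiag[OF md[OF that]] .
    thus ?thesis by (simp add: image_image)
  qed
  \<comment> \<open>Taking images does not increase cardinality, and two reflections give back
    \<open>D\<close>.\<close>
  have "card (?r ` D) = card D"
    using card_image_le[of D ?r] card_image_le[of "?r ` D" ?r] finite_dissection[OF D] rr by simp
  moreover have "is_mdiag n m d" if "d \<in> ?r ` D" for d using that md is_mdiag_reflect[OF m] by blast
  moreover have "\<not> crossing d e" if de: "d \<in> ?r ` D" "e \<in> ?r ` D" for d e
  proof -
    obtain d' e' where "d' \<in> D" "e' \<in> D" "d = ?r d'" "e = ?r e'" using de by blast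
    moreover have "\<not> crossing d' e'" using D calculation by (simp add: dissections_def)
    ultimately show ?thesis using crossing_reflect[OF md md] by simp
  qed
  ultimately show "?r ` D \<in> dissections n m" using D by (simp add: dissections_def)
qed

lemma card_dissections_reflect:
  assumes m: "0 < m" and X: "\<And>d. d \<in> X \<Longrightarrow> is_mdiag n m d"
  shows "card {D \<in> dissections n m. reflect_diag (m * (n + 1) + 1) ` X \<subseteq> D} =
    card {D \<in> dissections n m. X \<subseteq> D}"
proof -
  let ?r = "reflect_diag (m * (n + 1) + 1)"
  have "?r ` ?r ` X = X" using reflect_reflect_mdiag[OF X] by (simp add: image_image)
  note rX = this
  have "bij_betw ((`) ?r) {D \<in> dissections n m. ?r ` X \<subseteq> D} {D \<in> dissections n m. X \<subseteq> D}"
  proof (rule bij_betw_byWitness[where f' = "(`) ?r"])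
    show "\<forall>D\<in>{D \<in> dissections n m. ?r ` X \<subseteq> D}. ?r ` ?r ` D = D"
      "\<forall>D\<in>{D \<in> dissections n m. X \<subseteq> D}. ?r ` ?r ` D = D"
      using reflect_dissection(2)[OF m] by auto
    show "(`) ?r ` {D \<in> dissections n m. ?r ` X \<subseteq> D} \<subseteq> {D \<in> dissections n m. X \<subseteq> D}"
    proof safe
      fix D d assume "D \<in> dissections n m" "?r ` X \<subseteq> D" "d \<in> X"
      thus "d \<in> ?r ` D" using rX by blast
    qed (rule reflect_dissection(1)[OF m])
    show "(`) ?r ` {D \<in> dissections n m. X \<subseteq> D} \<subseteq> {D \<in> dissections n m. ?r ` X \<subseteq> D}"
      using reflect_dissection(1)[OF m] by blast
  qed
  thus ?thesis by (rule bij_betw_same_card)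
qed

text \<open>All prescribed diagonals besides the cut lie in the inner polygon, so the outer polygon
  contributes the full number of its dissections.\<close>

lemma card_dissections_join:
  assumes m: "0 < m" and v: "v \<le> m * (n' + 1)" and X: "\<And>d. d \<in> X \<Longrightarrow> is_mdiag k m d"
  shows "card {D \<in> dissections (n' + k + 1) m. (v, v + 1 + m * (k + 1)) \<in> D \<and> inner_diag v ` X \<subseteq> D} =
    card (dissections n' m) * card {B \<in> dissections k m. X \<subseteq> B}"
proof -
  define J where "J = (\<lambda>(A, B). join v (m * (k + 1)) A B)"
  have iff: "inner_diag v ` X \<subseteq> J p \<longleftrightarrow> X \<subseteq> snd p" if "p \<in> dissections n' m \<times> dissections k m" for p
  proof -
    have nc: "noncrossing_mdiags n' m (fst p)" "noncrossing_mdiags k m (snd p)"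
      using that by (auto simp: dissections_eq)
    have "inner_diag v d \<in> J p \<longleftrightarrow> d \<in> snd p" if "d \<in> X" for d
      using join_mem(1)[OF nc m X[OF that], of v] by (simp add: J_def case_prod_unfold)
    thus ?thesis by blast
  qed
  have "bij_betw J {p \<in> dissections n' m \<times> dissections k m. X \<subseteq> snd p}
    {D \<in> {D \<in> dissections (n' + k + 1) m. (v, v + 1 + m * (k + 1)) \<in> D}. inner_diag v ` X \<subseteq> D}"
    using bij_betw_join[OF m v, of k] iff unfolding J_def by (intro bij_betw_Collect) auto
  hence "card {p \<in> dissections n' m \<times> dissections k m. X \<subseteq> snd p} =
    card {D \<in> {D \<in> dissections (n' + k + 1) m. (v, v + 1 + m * (k + 1)) \<in> D}. inner_diag v ` X \<subseteq> D}"
    by (rule bij_betw_same_card)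
  moreover have "{p \<in> dissections n' m \<times> dissections k m. X \<subseteq> snd p} =
    dissections n' m \<times> {B \<in> dissections k m. X \<subseteq> B}" by auto
  ultimately show ?thesis by (simp add: card_cartesian_product conj_assoc)
qed

section \<open>The diagonals of the negative simple roots\<close>

lemma neg_simple_diag_eq:
  assumes "1 \<le> i"
  shows "neg_simple_diag n m i = (m * (i div 2), m * (n + 1 - (i + 1) div 2) + 1)"
proof (cases "odd i")
  case True
  then obtain p where "i = 2 * p + 1" by (elim oddE)
  thus ?thesis by (simp add: neg_simple_diag_def Let_def mult.commute)
next
  case False
  then obtain p where "i = 2 * p" by (auto elim: evenE)
  thus ?thesis by (simp add: neg_simple_diag_def Let_def mult.commute)
qed

text \<open>The right end is rewritten as left end plus length. The diagonal of index
  \<open>n' + 1\<close> thus has the form of a gluing diagonal whose inner polygon has parameter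
  \<open>k\<close>.\<close>

lemma neg_simple_diag_split:
  assumes "n = n' + k + 1"
  shows "neg_simple_diag n m (n' + 1) = (m * ((n' + 1) div 2), m * ((n' + 1) div 2) + 1 + m * (k + 1))"
proof -
  have "n + 1 - (n' + 1 + 1) div 2 = (n' + 1) div 2 + (k + 1)" using assms by presburger
  thus ?thesis by (simp add: neg_simple_diag_eq distrib_left)
qed

lemma is_mdiag_neg_simple_diag:
  assumes m: "0 < m" and i: "1 \<le> i" "i \<le> n"
  shows "is_mdiag n m (neg_simple_diag n m i)"
proof -
  define n' k where "n' = i - 1" and "k = n - i"
  have n: "n = n' + k + 1" and i': "i = n' + 1" using i by (auto simp: n'_def k_def)
  have "(n' + 1) div 2 \<le> n' + 1" by simp
  hence "m * ((n' + 1) div 2) \<le> m * (n' + 1)" by (rule mult_le_mono2)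
  from is_mdiag_join(3)[OF m this, of k] show ?thesis
    using neg_simple_diag_split[OF n, of m] unfolding i' n by simp
qed

text \<open>Each diagonal of the snake cuts off a polygon in which the rest of the snake is again a snake,
  starting at the other end of the base edge when \<open>i\<close> is odd.\<close>

lemma neg_simple_diag_inner:
  assumes n: "n = n' + k + 1" and j: "1 \<le> j" "j \<le> k"
  shows "neg_simple_diag n m (n' + 1 + j) = inner_diag (m * ((n' + 1) div 2))
    (if even (n' + 1) then neg_simple_diag k m j
     else reflect_diag (m * (k + 1) + 1) (neg_simple_diag k m j))"
proof (cases "even (n' + 1)")
  case True
  then obtain p where p: "n' + 1 = 2 * p" by (elim evenE)
  have q: "(j + 1) div 2 \<le> k + 1" "j div 2 \<le> k + 1"
    using div_le_dividend[of "j + 1" 2] div_le_dividend[of j 2] j by linarith+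
  have s: "n' + 1 + j = 2 * p + j" "n' + 1 + j + 1 = 2 * p + (j + 1)" using p by simp_all
  have d: "(2 * p + j) div 2 = p + j div 2" "(2 * p + (j + 1)) div 2 = p + (j + 1) div 2"
    by (rule div_mult_self4; simp)+
  have e: "(n' + 1 + j) div 2 = p + j div 2" "(n' + 1) div 2 = p"
    "n + 1 - (n' + 1 + j + 1) div 2 = p + (k + 1 - (j + 1) div 2)"
    unfolding s d using p n q by linarith+
  have "neg_simple_diag n m (n' + 1 + j) =
      (m * p + m * (j div 2), m * p + (m * (k + 1 - (j + 1) div 2) + 1))"
    using neg_simple_diag_eq[of "n' + 1 + j" n m] unfolding e by (simp add: distrib_left)
  thus ?thesis unfolding if_P[OF True] e neg_simple_diag_eq[OF j(1)] inner_diag_simp .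
next
  case False
  then obtain p where p: "n' + 1 = 2 * p + 1" by (elim oddE)
  have q: "(j + 1) div 2 \<le> k + 1" "j div 2 \<le> k + 1"
    using div_le_dividend[of "j + 1" 2] div_le_dividend[of j 2] j by linarith+
  have s: "n' + 1 + j = 2 * p + (j + 1)" "n' + 1 + j + 1 = 2 * (p + 1) + j" using p by simp_all
  have d: "(2 * p + (j + 1)) div 2 = p + (j + 1) div 2" "(2 * (p + 1) + j) div 2 = p + 1 + j div 2"
    by (rule div_mult_self4; simp)+
  have e: "(n' + 1 + j) div 2 = p + (j + 1) div 2" "(n' + 1) div 2 = p"
    "n + 1 - (n' + 1 + j + 1) div 2 = p + (k + 1 - j div 2)"
    unfolding s d using p n q by linarith+
  have "m * (k + 1) = m * (k + 1 - (j + 1) div 2) + m * ((j + 1) div 2)"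
    "m * (k + 1) = m * (k + 1 - j div 2) + m * (j div 2)"
    using q by (simp_all flip: distrib_left)
  \<comment> \<open>Reflection exchanges the roles of \<open>j div 2\<close> and
    \<open>(j + 1) div 2\<close>, just as an odd offset does in the larger snake.\<close>
  hence "m * (k + 1) + 1 - (m * (k + 1 - (j + 1) div 2) + 1) = m * ((j + 1) div 2)"
    "m * (k + 1) + 1 - m * (j div 2) = m * (k + 1 - j div 2) + 1" by linarith+
  hence "reflect_diag (m * (k + 1) + 1) (neg_simple_diag k m j) =
      (m * ((j + 1) div 2), m * (k + 1 - j div 2) + 1)"
    unfolding neg_simple_diag_eq[OF j(1)] reflect_diag_def fst_conv snd_conv by simp
  moreover have "neg_simple_diag n m (n' + 1 + j) =
      (m * p + m * ((j + 1) div 2), m * p + (m * (k + 1 - j div 2) + 1))"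
    using neg_simple_diag_eq[of "n' + 1 + j" n m] unfolding e by (simp add: distrib_left)
  ultimately show ?thesis unfolding if_not_P[OF False] e by (simp only: inner_diag_simp)
qed

text \<open>The cut is made at the smallest index in \<open>I\<close>. Every other prescribed
  diagonal then lies in the inner polygon, and every other prescribed zero in the tail of the
  sequence, so both counts factor in the same way.\<close>

lemma card_dissections_snake:
  assumes m: "0 < m" and I: "I \<subseteq> {1..n}"
  shows "card {D \<in> dissections n m. neg_simple_diag n m ` I \<subseteq> D} =
    card {b \<in> ballot_seqs n m. \<forall>i\<in>I. b ! i = 0}"
  using I
proof (induction n arbitrary: I rule: less_induct)
  case (less n)
  show ?case
  proof (cases "I = {}")
    case True
    thus ?thesis using card_dissections[OF m] by simp
  next
    case False
    have fin: "finite I" using less.prems by (rule finite_subset) simp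
    define i where "i = Min I"
    have i: "i \<in> I" "\<And>j. j \<in> I \<Longrightarrow> i \<le> j" using fin False by (auto simp: i_def)
    define n' k where "n' = i - 1" and "k = n - i"
    have "1 \<le> i" "i \<le> n" using i(1) less.prems by auto
    hence n: "n = n' + k + 1" and i': "i = n' + 1" by (auto simp: n'_def k_def)
    define K where "K = {j. 1 \<le> j \<and> n' + 1 + j \<in> I}"
    have K: "K \<subseteq> {1..k}" using less.prems n by (auto simp: K_def)
    have IK: "I = insert (n' + 1) ((+) (n' + 1) ` K)"
    proof (intro equalityI subsetI)
      fix j assume j: "j \<in> I"
      show "j \<in> insert (n' + 1) ((+) (n' + 1) ` K)"
      proof (cases "j = n' + 1")
        case False
        hence "j - (n' + 1) \<in> K" "j = (n' + 1) + (j - (n' + 1))" using i(2)[OF j] j i' by (auto simp: K_def)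
        thus ?thesis by blast
      qed simp
    qed (use i i' in \<open>auto simp: K_def\<close>)
    define v where "v = m * ((n' + 1) div 2)"
    have "(n' + 1) div 2 \<le> n' + 1" by simp
    hence v: "v \<le> m * (n' + 1)" unfolding v_def by (rule mult_le_mono2)
    define h where "h d = (if even (n' + 1) then d else reflect_diag (m * (k + 1) + 1) d)" for d
    define X where "X = neg_simple_diag k m ` K"
    have X: "is_mdiag k m d" if "d \<in> X" for d
      using that K is_mdiag_neg_simple_diag[OF m, of _ k] by (auto simp: X_def)
    have hX: "is_mdiag k m d" if "d \<in> h ` X" for d
    proof -
      obtain x where "x \<in> X" "d = h x" using \<open>d \<in> h ` X\<close> by blast
      thus ?thesis using X[of x] is_mdiag_reflect[OF m X, of x] by (simp add: h_def)
    qed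
    have s: "neg_simple_diag n m (n' + 1) = (v, v + 1 + m * (k + 1))"
      using neg_simple_diag_split[OF n] by (simp add: v_def)
    have "neg_simple_diag n m (n' + 1 + j) = inner_diag v (h (neg_simple_diag k m j))" if "j \<in> K" for j
      using neg_simple_diag_inner[OF n, of j m] that K unfolding v_def h_def by auto
    hence img: "neg_simple_diag n m ` ((+) (n' + 1) ` K) = inner_diag v ` h ` X"
      unfolding X_def image_image by (rule image_cong[OF refl])
    have "{D \<in> dissections n m. neg_simple_diag n m ` I \<subseteq> D} =
        {D \<in> dissections (n' + k + 1) m. (v, v + 1 + m * (k + 1)) \<in> D \<and> inner_diag v ` h ` X \<subseteq> D}"
      unfolding IK image_insert img s insert_subset n[symmetric] ..
    hence "card {D \<in> dissections n m. neg_simple_diag n m ` I \<subseteq> D} =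
        card (dissections n' m) * card {B \<in> dissections k m. h ` X \<subseteq> B}"
      using card_dissections_join[OF m v hX] by simp
    \<comment> \<open>For odd \<open>n' + 1\<close> the inner snake appears mirrored; the count is
      invariant under reflection.\<close>
    also have "card {B \<in> dissections k m. h ` X \<subseteq> B} = card {B \<in> dissections k m. X \<subseteq> B}"
    proof (cases "even (n' + 1)")
      case True
      thus ?thesis by (simp add: h_def)
    next
      case False
      hence "h ` X = reflect_diag (m * (k + 1) + 1) ` X" unfolding h_def by (simp only: if_False)
      thus ?thesis using card_dissections_reflect[OF m X] by simp
    qed
    also have "\<dots> = card {b \<in> ballot_seqs k m. \<forall>j\<in>K. b ! j = 0}"
      unfolding X_def using n K by (intro less.IH) auto
    also have "card (dissections n' m) = card (ballot_seqs n' m)" by (rule card_dissections[OF m])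
    also have "card (ballot_seqs n' m) * card {b \<in> ballot_seqs k m. \<forall>j\<in>K. b ! j = 0} =
        card {b \<in> ballot_seqs n m. b ! (n' + 1) = 0 \<and> (\<forall>j\<in>K. b ! (n' + 1 + j) = 0)}"
      by (rule card_ballot_seqs_zero[OF n K, symmetric])
    also have "{b \<in> ballot_seqs n m. b ! (n' + 1) = 0 \<and> (\<forall>j\<in>K. b ! (n' + 1 + j) = 0)} =
        {b \<in> ballot_seqs n m. \<forall>i\<in>I. b ! i = 0}"
      unfolding IK by simp
    finally show ?thesis .
  qed
qed

lemma ex_bij_dissections_zeros:
  assumes m: "0 < m"
  obtains h where "bij_betw h (dissections n m) (ballot_seqs n m)"
    "\<And>D i. D \<in> dissections n m \<Longrightarrow> i \<in> {1..n} \<Longrightarrow> neg_simple_diag n m i \<in> D \<longleftrightarrow> h D ! i = 0"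
proof -
  define f where "f D = {i \<in> {1..n}. neg_simple_diag n m i \<in> D}" for D
  define g where "g b = {i \<in> {1..n}. b ! i = 0}" for b :: "nat list"
  have "card {D \<in> dissections n m. I \<subseteq> f D} = card {b \<in> ballot_seqs n m. I \<subseteq> g b}"
    if "I \<subseteq> {1..n}" for I
  proof -
    have "I \<subseteq> f D \<longleftrightarrow> neg_simple_diag n m ` I \<subseteq> D" "I \<subseteq> g b \<longleftrightarrow> (\<forall>i\<in>I. b ! i = 0)" for D b
      using that by (auto simp: f_def g_def)
    thus ?thesis using card_dissections_snake[OF m that] by simp
  qed
  hence "card {D \<in> dissections n m. f D = I} = card {b \<in> ballot_seqs n m. g b = I}" for I
    by (intro card_fibres_eq_of_superset_counts[of _ _ "{1..n}"] finite_dissections finite_ballot_seqs)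
      (auto simp: f_def g_def)
  from bij_betw_Union_fibres[OF finite_dissections finite_ballot_seqs this]
  obtain h where h: "bij_betw h (dissections n m) (ballot_seqs n m)"
    "\<And>D. D \<in> dissections n m \<Longrightarrow> g (h D) = f D" by blast
  have "neg_simple_diag n m i \<in> D \<longleftrightarrow> h D ! i = 0" if "D \<in> dissections n m" "i \<in> {1..n}" for D i
    using h(2)[OF that(1)] that(2) unfolding f_def g_def by blast
  with h(1) show ?thesis by (rule that)
qed

section \<open>Dominant regions\<close>

lemma ip_posroot:
  assumes "1 \<le> i" "i \<le> j" "j \<le> n"
  shows "ip n v (posroot i j) = v i - v (j + 1)"
proof -
  have "ip n v (posroot i j) = (\<Sum>l=1..n+1. v l * eps i l) - (\<Sum>l=1..n+1. v l * eps (j + 1) l)"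
    unfolding ip_def posroot_def by (simp only: right_diff_distrib sum_subtractf)
  also have "(\<Sum>l=1..n+1. v l * eps i l) = v i"
    using assms by (simp add: eps_def if_distrib cong: if_cong)
  also have "(\<Sum>l=1..n+1. v l * eps (j + 1) l) = v (j + 1)"
    using assms by (simp add: eps_def if_distrib cong: if_cong)
  finally show ?thesis .
qed

text \<open>This describes the points inside the dominant chamber and off the arrangement, in terms
  of the first \<open>N\<close> coordinates only and without the sum-zero condition, so that
  coordinates can be added one at a time.\<close>

definition generic :: "nat \<Rightarrow> nat \<Rightarrow> (nat \<Rightarrow> real) \<Rightarrow> bool" where
  "generic N m x \<longleftrightarrow> (\<forall>i j. 1 \<le> i \<and> i < j \<and> j \<le> N \<longrightarrow>
     x j < x i \<and> (\<forall>k\<in>{1..m}. x i - x j \<noteq> real k))"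

lemma genericD:
  assumes "generic N m x" "1 \<le> i" "i < j" "j \<le> N"
  shows "x j < x i" and "1 \<le> k \<Longrightarrow> k \<le> m \<Longrightarrow> x i - x j \<noteq> real k"
  using assms by (auto simp: generic_def)

definition below :: "nat \<Rightarrow> (nat \<Rightarrow> real) \<Rightarrow> nat \<Rightarrow> real \<Rightarrow> (nat \<times> nat) set" where
  "below m x i z = {(j, k). j \<in> {1..i} \<and> k \<in> {1..m} \<and> x j - real k < z}"

definition below_seq :: "nat \<Rightarrow> nat \<Rightarrow> (nat \<Rightarrow> real) \<Rightarrow> nat list" where
  "below_seq n m x = map (\<lambda>i. card (below m x i (x (i + 1)))) [0..<n + 1]"

lemma below_subset: "below m x i z \<subseteq> {1..i} \<times> {1..m}"
  by (auto simp: below_def)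

lemma finite_below: "finite (below m x i z)"
  by (rule finite_subset[OF below_subset]) simp

lemma below_0 [simp]: "below m x 0 z = {}"
  by (auto simp: below_def)

lemma below_Suc:
  "below m x (Suc i) z = below m x i z \<union> {Suc i} \<times> {k \<in> {1..m}. x (Suc i) - real k < z}"
  by (auto simp: below_def le_Suc_eq)

lemma below_seq_nth: "i \<le> n \<Longrightarrow> below_seq n m x ! i = card (below m x i (x (i + 1)))"
  by (simp add: below_seq_def nth_append del: upt_Suc)

lemma length_below_seq [simp]: "length (below_seq n m x) = n + 1"
  by (simp add: below_seq_def)

text \<open>All \<open>m\<close> shifts of a coordinate lie below that coordinate. This is the
  source of the increment \<open>m\<close> in the ballot condition.\<close>

lemma card_below_self:
  "card (below m x (Suc i) (x (Suc i))) = card (below m x i (x (Suc i))) + m"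
proof -
  have "{k \<in> {1..m}. x (Suc i) - real k < x (Suc i)} = {1..m}" by auto
  hence "below m x (Suc i) (x (Suc i)) = below m x i (x (Suc i)) \<union> {Suc i} \<times> {1..m}"
    by (simp add: below_Suc)
  moreover have "below m x i (x (Suc i)) \<inter> {Suc i} \<times> {1..m} = {}"
    by (auto simp: below_def)
  ultimately show ?thesis
    by (simp add: card_Un_disjoint finite_below card_cartesian_product)
qed

lemma below_mono: "z \<le> z' \<Longrightarrow> below m x i z \<subseteq> below m x i z'"
  by (auto simp: below_def)

lemma below_seq_ballot:
  assumes "generic (n + 1) m x" "i < n"
  shows "below_seq n m x ! Suc i \<le> below_seq n m x ! i + m"
proof -
  have "x (Suc i + 1) \<le> x (Suc i)"
    using genericD(1)[OF assms(1), of "Suc i" "Suc i + 1"] assms(2) by simp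
  hence "card (below m x (Suc i) (x (Suc i + 1))) \<le> card (below m x (Suc i) (x (Suc i)))"
    by (intro card_mono finite_below below_mono)
  thus ?thesis using assms card_below_self[of m x i] by (simp add: below_seq_nth)
qed

text \<open>The smallest of the shifted numbers is \<open>x i - m\<close>, so nothing is counted
  exactly when this number is not below \<open>x (i + 1)\<close>; genericity rules out
  equality.\<close>

lemma below_seq_eq_0_iff:
  assumes x: "generic (n + 1) m x" and i: "1 \<le> i" "i \<le> n" and m: "0 < m"
  shows "below_seq n m x ! i = 0 \<longleftrightarrow> x i - x (i + 1) > real m"
proof -
  have ne: "x i - x (i + 1) \<noteq> real m" using x i m by (auto simp: generic_def)
  have "below m x i (x (i + 1)) = {} \<longleftrightarrow> real m \<le> x i - x (i + 1)"
  proof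
    assume "below m x i (x (i + 1)) = {}"
    hence "(i, m) \<notin> below m x i (x (i + 1))" by simp
    thus "real m \<le> x i - x (i + 1)" using i m by (simp add: below_def)
  next
    assume *: "real m \<le> x i - x (i + 1)"
    have "x (i + 1) \<le> x j - real k" if "j \<in> {1..i}" "k \<in> {1..m}" for j k
    proof -
      have "x i \<le> x j" using genericD(1)[OF x, of j i] i that by (cases "j = i") auto
      moreover have "real k \<le> real m" using that by simp
      ultimately show ?thesis using * by linarith
    qed
    thus "below m x i (x (i + 1)) = {}" by (fastforce simp: below_def)
  qed
  thus ?thesis using ne i by (simp add: below_seq_nth finite_below) linarith
qed

section \<open>The counts determine the position relative to the hyperplanes\<close>

definition same_pattern :: "nat \<Rightarrow> nat \<Rightarrow> (nat \<Rightarrow> real) \<Rightarrow> (nat \<Rightarrow> real) \<Rightarrow> bool" where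
  "same_pattern N m x y \<longleftrightarrow> (\<forall>i j k. 1 \<le> i \<and> i < j \<and> j \<le> N \<and> k \<in> {1..m} \<longrightarrow>
     (x i - x j < real k \<longleftrightarrow> y i - y j < real k))"

lemma same_patternD:
  assumes "same_pattern N m x y" "1 \<le> i" "i < j" "j \<le> N" "1 \<le> k" "k \<le> m"
  shows "x i - x j < real k \<longleftrightarrow> y i - y j < real k"
  using assms by (auto simp: same_pattern_def)

lemma same_pattern_below_seq:
  assumes "same_pattern (n + 1) m x y"
  shows "below_seq n m x = below_seq n m y"
proof (rule nth_equalityI)
  fix i assume "i < length (below_seq n m x)"
  hence i: "i \<le> n" by simp
  have "x j - real k < x (i + 1) \<longleftrightarrow> y j - real k < y (i + 1)" if "j \<in> {1..i}" "k \<in> {1..m}" for j k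
  proof -
    have "x j - x (i + 1) < real k \<longleftrightarrow> y j - y (i + 1) < real k"
      using assms that i by (auto simp: same_pattern_def)
    thus ?thesis by linarith
  qed
  hence "below m x i (x (i + 1)) = below m y i (y (i + 1))"
    unfolding below_def by blast
  thus "below_seq n m x ! i = below_seq n m y ! i" using i by (simp add: below_seq_nth)
qed simp

text \<open>The pattern of the first \<open>N\<close> coordinates determines the order of the numbers \<open>x\<^sub>j - k\<close>, and both
  sets below are initial segments of that order.\<close>

lemma same_pattern_Suc:
  assumes x: "generic (Suc N) m x" and y: "generic (Suc N) m y" and xy: "same_pattern N m x y"
    and card: "card (below m x N (x (Suc N))) = card (below m y N (y (Suc N)))"
  shows "same_pattern (Suc N) m x y"
proof -
  \<comment> \<open>Comparing two shifts means comparing a coordinate difference with a difference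
    of shifts. The pattern decides this if the latter has the sign of the former; otherwise the
    decreasing order of the coordinates does.\<close>
  have ord: "x i - real k < x j - real l \<longleftrightarrow> y i - real k < y j - real l"
    if ijkl: "i \<in> {1..N}" "j \<in> {1..N}" "k \<in> {1..m}" "l \<in> {1..m}" for i j k l
  proof (cases i j rule: linorder_cases)
    case less
    show ?thesis
    proof (cases "l < k")
      case True
      have "x i - x j < real (k - l) \<longleftrightarrow> y i - y j < real (k - l)"
        using less ijkl True by (intro same_patternD[OF xy]) auto
      thus ?thesis using True by (simp add: of_nat_diff) linarith
    next
      case False
      have "x j < x i" "y j < y i" using x y less ijkl by (auto simp: generic_def)
      thus ?thesis using False by simp
    qed
  next
    case greater
    show ?thesis
    proof (cases "k < l")
      case True
      have "x j - x i < real (l - k) \<longleftrightarrow> y j - y i < real (l - k)"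
        using greater ijkl True by (intro same_patternD[OF xy]) auto
      moreover have "x j - x i \<noteq> real (l - k)" "y j - y i \<noteq> real (l - k)"
        using greater ijkl True by (intro genericD[OF x] genericD[OF y]; auto)+
      ultimately show ?thesis using True by (simp add: of_nat_diff) linarith
    next
      case False
      have "x i < x j" "y i < y j" using x y greater ijkl by (auto simp: generic_def)
      thus ?thesis using False by simp
    qed
  qed simp
  define A where "A = below m x N (x (Suc N))"
  define B where "B = below m y N (y (Suc N))"
  have fin: "finite A" "finite B" by (simp_all add: A_def B_def finite_below)
  \<comment> \<open>Initial segments of one order are nested, so equal finite cardinality will force
    them to coincide.\<close>
  have "A \<subseteq> B \<or> B \<subseteq> A"
  proof (rule disjCI)
    assume "\<not> B \<subseteq> A"
    then obtain j l where l: "(j, l) \<in> B" "(j, l) \<notin> A" by auto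
    show "A \<subseteq> B"
    proof safe
      fix i k assume k: "(i, k) \<in> A"
      have *: "i \<in> {1..N}" "j \<in> {1..N}" "k \<in> {1..m}" "l \<in> {1..m}"
        using k l by (auto simp: A_def B_def below_def)
      have "x i - real k < x j - real l" using k l * by (auto simp: A_def below_def)
      hence "y i - real k < y j - real l" using ord[OF *] by simp
      thus "(i, k) \<in> B" using l * by (auto simp: B_def below_def)
    qed
  qed
  hence eq: "A = B" using card fin unfolding A_def[symmetric] B_def[symmetric]
    by (metis card_subset_eq)
  show ?thesis
    unfolding same_pattern_def
  proof (intro allI impI, elim conjE)
    fix i j k assume *: "1 \<le> i" "i < j" "j \<le> Suc N" "k \<in> {1..m}"
    show "x i - x j < real k \<longleftrightarrow> y i - y j < real k"
    proof (cases "j = Suc N")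
      case True
      hence "(i, k) \<in> A \<longleftrightarrow> (i, k) \<in> B" using eq by simp
      hence "x i - real k < x j \<longleftrightarrow> y i - real k < y j"
        using * True by (simp add: A_def B_def below_def)
      thus ?thesis by linarith
    qed (use * xy in \<open>simp add: same_pattern_def\<close>)
  qed
qed

text \<open>Coordinates are added one by one: entry \<open>N\<close> of the sequence places
  coordinate \<open>N + 1\<close> among the shifts of the earlier ones.\<close>

lemma below_seq_eq_imp_same_pattern:
  assumes "generic (n + 1) m x" "generic (n + 1) m y" "below_seq n m x = below_seq n m y"
  shows "same_pattern (n + 1) m x y"
proof -
  have "same_pattern N m x y" if "N \<le> n + 1" for N
    using that
  proof (induction N)
    case (Suc N)
    have "generic (Suc N) m x" "generic (Suc N) m y"
      using assms Suc.prems by (auto simp: generic_def)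
    moreover have "card (below m x N (x (Suc N))) = card (below m y N (y (Suc N)))"
      using below_seq_nth[of N n m x] below_seq_nth[of N n m y] Suc.prems assms(3) by simp
    ultimately show ?case using Suc by (intro same_pattern_Suc) auto
  qed (simp add: same_pattern_def)
  thus ?thesis by simp
qed

section \<open>Realizing every ballot sequence\<close>

lemma ex_real_with_card_less:
  fixes A :: "real set"
  assumes "finite A" "\<And>a. a \<in> A \<Longrightarrow> a < u" "c \<le> card A"
  shows "\<exists>z<u. z \<notin> A \<and> card {a \<in> A. a < z} = c"
  using assms
proof (induction A arbitrary: u rule: finite_linorder_max_induct)
  case empty
  thus ?case by (intro exI[of _ "u - 1"]) auto
next
  case (insert b A)
  have bA: "b \<notin> A" using insert.hyps by auto
  \<comment> \<open>Here \<open>b\<close> is the maximum. Either \<open>A\<close> alone suffices and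
    \<open>z\<close> is sought below \<open>b\<close>, or everything must be counted and
    \<open>z\<close> is put between \<open>b\<close> and \<open>u\<close>.\<close>
  show ?case
  proof (cases "c \<le> card A")
    case True
    then obtain z where z: "z < b" "z \<notin> A" "card {a \<in> A. a < z} = c"
      using insert.IH[of b] insert.hyps by blast
    have "{a \<in> insert b A. a < z} = {a \<in> A. a < z}" using z by auto
    thus ?thesis using z insert.prems(1)[of b] by (intro exI[of _ z]) auto
  next
    case False
    hence c: "c = card (insert b A)" using insert.prems(2) insert.hyps bA by simp
    obtain z where z: "b < z" "z < u" using dense insert.prems(1)[of b] by blast
    hence "{a \<in> insert b A. a < z} = insert b A" using insert.hyps by force
    thus ?thesis using z c insert.hyps by (intro exI[of _ z]) auto
  qed
qed

text \<open>A coincidence of shifts of different coordinates would make a positive coordinate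
  difference nonpositive or equal to a forbidden integer. Counting pairs is thus the same as
  counting values.\<close>

lemma inj_on_shifts:
  assumes "generic N m x"
  shows "inj_on (\<lambda>(j, k). x j - real k) ({1..N} \<times> {1..m})"
proof -
  have *: "x i - real k \<noteq> x j - real l"
    if "i \<in> {1..N}" "j \<in> {1..N}" "k \<in> {1..m}" "l \<in> {1..m}" "i < j" for i j k l
  proof (cases "k \<le> l")
    case True
    thus ?thesis using that assms by (fastforce simp: generic_def)
  next
    case False
    hence "x i - x j \<noteq> real (k - l)" using that by (intro genericD[OF assms]) auto
    thus ?thesis using False by (simp add: of_nat_diff)
  qed
  show ?thesis
  proof (rule inj_onI, clarify)
    fix i k j l assume a: "i \<in> {1..N}" "k \<in> {1..m}" "j \<in> {1..N}" "l \<in> {1..m}" "x i - real k = x j - real l"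
    hence "i = j" using *[of i j k l] *[of j i l k] by (metis linorder_neqE_nat)
    thus "i = j \<and> k = l" using a by simp
  qed
qed

text \<open>The next coordinate has to lie below the last one, avoid all shifts and have a
  prescribed number of shifts below it. The last coordinate has \<open>c n + m\<close> shifts below
  it, so the ballot condition leaves room.\<close>

lemma ex_generic_below:
  assumes "c 0 = 0" "\<And>i. i < n \<Longrightarrow> c (Suc i) \<le> c i + m"
  shows "\<exists>x. generic (n + 1) m x \<and> (\<forall>i\<le>n. card (below m x i (x (i + 1))) = c i)"
  using assms(2)
proof (induction n)
  case 0
  show ?case using assms(1) by (auto simp: generic_def)
next
  case (Suc n)
  then obtain x where x: "generic (n + 1) m x" "\<And>i. i \<le> n \<Longrightarrow> card (below m x i (x (i + 1))) = c i"
    by auto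
  define f where "f = (\<lambda>(j, k). x j - real k)"
  \<comment> \<open>Shifts that are not below \<open>x (n + 1)\<close> cannot equal the new
    coordinate, so only the shifts in \<open>A\<close> need to be avoided.\<close>
  define A where "A = f ` below m x (n + 1) (x (n + 1))"
  have inj: "inj_on f ({1..n + 1} \<times> {1..m})" unfolding f_def by (rule inj_on_shifts[OF x(1)])
  have "card A = card (below m x (n + 1) (x (n + 1)))"
    unfolding A_def using inj below_subset by (intro card_image inj_on_subset[OF inj])
  also have "\<dots> = c n + m" using card_below_self[of m x n] x(2)[of n] by simp
  finally have card: "c (Suc n) \<le> card A" using Suc.prems[of n] by simp
  have "finite A" "\<And>a. a \<in> A \<Longrightarrow> a < x (n + 1)"
    unfolding A_def f_def by (auto simp: finite_below) (auto simp: below_def)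
  from ex_real_with_card_less[OF this card] obtain z where
    z: "z < x (n + 1)" "z \<notin> A" "card {a \<in> A. a < z} = c (Suc n)" by blast
  define y where "y = x(n + 2 := z)"
  have yx: "y i = x i" if "i \<noteq> n + 2" for i using that by (simp add: y_def)
  have yz: "y (n + 2) = z" by (simp add: y_def)
  have below_y: "below m y i w = below m x i w" if "i \<le> n + 1" for i w
    using that by (auto simp: below_def y_def)
  have "generic (n + 2) m y"
    unfolding generic_def
  proof (intro allI impI)
    fix i j assume ij: "1 \<le> i \<and> i < j \<and> j \<le> n + 2"
    show "y j < y i \<and> (\<forall>k\<in>{1..m}. y i - y j \<noteq> real k)"
    proof (cases "j = n + 2")
      case True
      have xi: "x (n + 1) \<le> x i"
        using x(1) ij True by (cases "i = n + 1") (auto simp: generic_def intro: less_imp_le)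
      have "x i - z \<noteq> real k" if k: "k \<in> {1..m}" for k
      proof
        assume "x i - z = real k"
        hence fz: "f (i, k) = z" by (simp add: f_def)
        hence "(i, k) \<in> below m x (n + 1) (x (n + 1))"
          using z(1) k ij True by (auto simp: below_def f_def)
        thus False using fz z(2) unfolding A_def by blast
      qed
      thus ?thesis using xi z(1) ij True yx[of i] yz by simp
    qed (use x(1) ij yx in \<open>simp add: generic_def\<close>)
  qed
  moreover have "card (below m y i (y (i + 1))) = c i" if "i \<le> Suc n" for i
  proof (cases "i = Suc n")
    case True
    have "f ` below m x (n + 1) z = {a \<in> A. a < z}"
      using z(1) unfolding A_def f_def by (force simp: below_def)
    moreover have "card (f ` below m x (n + 1) z) = card (below m x (n + 1) z)"
      using below_subset by (intro card_image inj_on_subset[OF inj])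
    ultimately show ?thesis using z(3) below_y[of "n + 1"] True yz by simp
  qed (use that x(2)[of i] below_y[of i] yx[of "i + 1"] in simp)
  ultimately show ?case by auto
qed

section \<open>Regions as cells of constant counts\<close>

lemma cat_complement_iff:
  "v \<in> cat_complement n m \<longleftrightarrow> v \<in> Vsp n \<and>
    (\<forall>i j k. 1 \<le> i \<and> i < j \<and> j \<le> n + 1 \<and> k \<le> m \<longrightarrow> v i - v j \<noteq> real k)"
proof -
  have "v \<in> \<Union>(cat_arr n m) \<longleftrightarrow> (\<exists>i j k. 1 \<le> i \<and> i < j \<and> j \<le> n + 1 \<and> k \<le> m \<and> v i - v j = real k)"
    if "v \<in> Vsp n"
  proof
    assume "v \<in> \<Union>(cat_arr n m)"
    then obtain i j k where *: "1 \<le> i" "i \<le> j" "j \<le> n" "k \<le> m" "ip n v (posroot i j) = real k"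
      unfolding cat_arr_def is_posroot_def hyp_def by auto
    hence "v i - v (j + 1) = real k" using ip_posroot[of i j n v] by simp
    thus "\<exists>i j k. 1 \<le> i \<and> i < j \<and> j \<le> n + 1 \<and> k \<le> m \<and> v i - v j = real k"
      using * by (intro exI[of _ i] exI[of _ "j + 1"] exI[of _ k]) auto
  next
    assume "\<exists>i j k. 1 \<le> i \<and> i < j \<and> j \<le> n + 1 \<and> k \<le> m \<and> v i - v j = real k"
    then obtain i j k where *: "1 \<le> i" "i < j" "j \<le> n + 1" "k \<le> m" "v i - v j = real k" by blast
    have "ip n v (posroot i (j - 1)) = real k" using ip_posroot[of i "j - 1" n v] * by simp
    hence "v \<in> hyp n (posroot i (j - 1)) (int k)" using that by (simp add: hyp_def)
    moreover have "is_posroot n (posroot i (j - 1))"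
      unfolding is_posroot_def using * by (intro exI[of _ i] exI[of _ "j - 1"]) auto
    ultimately show "v \<in> \<Union>(cat_arr n m)" using * unfolding cat_arr_def by blast
  qed
  thus ?thesis unfolding cat_complement_def by blast
qed

lemma dominant_chamber_iff:
  "v \<in> dominant_chamber n \<longleftrightarrow> v \<in> Vsp n \<and> (\<forall>i j. 1 \<le> i \<and> i < j \<and> j \<le> n + 1 \<longrightarrow> v j \<le> v i)"
proof -
  have "(\<forall>a. is_posroot n a \<longrightarrow> 0 \<le> ip n v a) \<longleftrightarrow>
    (\<forall>i j. 1 \<le> i \<and> i < j \<and> j \<le> n + 1 \<longrightarrow> v j \<le> v i)"
  proof (intro iffI allI impI)
    fix i j assume *: "\<forall>a. is_posroot n a \<longrightarrow> 0 \<le> ip n v a" "1 \<le> i \<and> i < j \<and> j \<le> n + 1"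
    hence "is_posroot n (posroot i (j - 1))"
      unfolding is_posroot_def by (intro exI[of _ i] exI[of _ "j - 1"]) auto
    with * have "0 \<le> ip n v (posroot i (j - 1))" by blast
    moreover have "i \<le> j - 1" "j - 1 \<le> n" "j - 1 + 1 = j" using * by auto
    ultimately show "v j \<le> v i" using * ip_posroot[of i "j - 1" n v] by simp
  next
    fix a assume *: "\<forall>i j. 1 \<le> i \<and> i < j \<and> j \<le> n + 1 \<longrightarrow> v j \<le> v i" "is_posroot n a"
    then obtain i j where "1 \<le> i" "i \<le> j" "j \<le> n" "a = posroot i j" by (auto simp: is_posroot_def)
    thus "0 \<le> ip n v a" using *(1)[rule_format, of i "j + 1"] ip_posroot[of i j n v] by simp
  qed
  thus ?thesis by (simp add: dominant_chamber_def)
qed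

text \<open>Avoiding the hyperplanes with \<open>k = 0\<close> turns the weak inequalities of the
  dominant chamber into strict ones.\<close>

lemma dominant_complement_iff:
  "v \<in> cat_complement n m \<and> v \<in> dominant_chamber n \<longleftrightarrow> v \<in> Vsp n \<and> generic (n + 1) m v"
proof
  assume "v \<in> cat_complement n m \<and> v \<in> dominant_chamber n"
  hence v: "v \<in> Vsp n" and ne: "\<And>i j k. 1 \<le> i \<Longrightarrow> i < j \<Longrightarrow> j \<le> n + 1 \<Longrightarrow> k \<le> m \<Longrightarrow> v i - v j \<noteq> real k"
    and le: "\<And>i j. 1 \<le> i \<Longrightarrow> i < j \<Longrightarrow> j \<le> n + 1 \<Longrightarrow> v j \<le> v i"
    unfolding cat_complement_iff dominant_chamber_iff by auto
  have "v j < v i" if "1 \<le> i" "i < j" "j \<le> n + 1" for i j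
    using ne[OF that, of 0] le[OF that] by simp
  thus "v \<in> Vsp n \<and> generic (n + 1) m v" using v ne by (auto simp: generic_def)
next
  assume v: "v \<in> Vsp n \<and> generic (n + 1) m v"
  have "v i - v j \<noteq> real k" if "1 \<le> i" "i < j" "j \<le> n + 1" "k \<le> m" for i j k
    using genericD(1)[of "n + 1" m v i j] genericD(2)[of "n + 1" m v i j k] v that by (cases "k = 0") auto
  moreover have "v j \<le> v i" if "1 \<le> i" "i < j" "j \<le> n + 1" for i j
    using genericD(1)[of "n + 1" m v i j] v that by simp
  ultimately show "v \<in> cat_complement n m \<and> v \<in> dominant_chamber n"
    using v unfolding cat_complement_iff dominant_chamber_iff by blast
qed

lemma convex_comb_ne:
  fixes a b c t :: real
  assumes "0 \<le> t" "t \<le> 1" "(a < c \<and> b < c) \<or> (c < a \<and> c < b)"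
  shows "(1 - t) * a + t * b \<noteq> c"
proof -
  have "(1 - t) * (a - c) + t * (b - c) \<noteq> 0"
    using assms(3)
  proof
    assume *: "a < c \<and> b < c"
    have "(1 - t) * (c - a) + t * (c - b) > 0"
      using assms * by (cases "t = 0") (auto intro!: add_nonneg_pos)
    thus ?thesis by (simp add: algebra_simps)
  next
    assume *: "c < a \<and> c < b"
    have "(1 - t) * (a - c) + t * (b - c) > 0"
      using assms * by (cases "t = 0") (auto intro!: add_nonneg_pos)
    thus ?thesis by simp
  qed
  thus ?thesis by (simp add: algebra_simps)
qed

definition cell :: "nat \<Rightarrow> nat \<Rightarrow> nat list \<Rightarrow> (nat \<Rightarrow> real) set" where
  "cell n m b = {x \<in> Vsp n. generic (n + 1) m x \<and> below_seq n m x = b}"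

lemma Vsp_convex_comb:
  assumes "x \<in> Vsp n" "y \<in> Vsp n"
  shows "(\<lambda>l. (1 - t) * x l + t * y l) \<in> Vsp n"
  using assms by (simp add: Vsp_def sum.distrib del: sum.cl_ivl_Suc flip: sum_distrib_left)

text \<open>Both points lie strictly on the same side of every hyperplane, hence so does the segment
  between them.\<close>

lemma same_pattern_connected:
  assumes x: "x \<in> Vsp n" "generic (n + 1) m x" and y: "y \<in> Vsp n" "generic (n + 1) m y"
    and xy: "same_pattern (n + 1) m x y"
  shows "connected_component (cat_complement n m) x y"
proof -
  define f where "f t = (\<lambda>l. (1 - t) * x l + t * y l)" for t :: real
  have "continuous_on {0..1} f"
    unfolding f_def by (intro continuous_on_coordinatewise_then_product continuous_intros)
  hence "connected (f ` {0..1})" by (intro connected_continuous_image) auto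
  moreover have "f 0 = x" "f 1 = y" by (auto simp: f_def)
  hence "x \<in> f ` {0..1}" "y \<in> f ` {0..1}" by force+
  moreover have "f t \<in> cat_complement n m" if t: "0 \<le> t" "t \<le> 1" for t
    unfolding cat_complement_iff
  proof (intro conjI allI impI)
    show "f t \<in> Vsp n" unfolding f_def by (rule Vsp_convex_comb[OF x(1) y(1)])
    fix i j k assume *: "1 \<le> i \<and> i < j \<and> j \<le> n + 1 \<and> k \<le> m"
    have "(x i - x j < real k \<and> y i - y j < real k) \<or> (real k < x i - x j \<and> real k < y i - y j)"
    proof (cases "k = 0")
      case True
      thus ?thesis using genericD(1)[OF x(2), of i j] genericD(1)[OF y(2), of i j] * by simp
    next
      case False
      thus ?thesis
        using genericD(2)[OF x(2), of i j k] genericD(2)[OF y(2), of i j k]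
          same_patternD[OF xy, of i j k] * by linarith
    qed
    from convex_comb_ne[OF t this] show "f t i - f t j \<noteq> real k"
      by (simp add: f_def algebra_simps)
  qed
  hence "f ` {0..1} \<subseteq> cat_complement n m" by auto
  ultimately show ?thesis unfolding connected_component_def by blast
qed

text \<open>By the intermediate value property, a coordinate difference cannot pass a forbidden
  value on a connected subset of the complement. Taking \<open>k = 0\<close> as well shows that the
  second point is dominant.\<close>

lemma connected_same_pattern:
  assumes x: "x \<in> Vsp n" "generic (n + 1) m x" and xy: "connected_component (cat_complement n m) x y"
  shows "y \<in> Vsp n" "generic (n + 1) m y" "same_pattern (n + 1) m x y"
proof -
  obtain T where T: "connected T" "T \<subseteq> cat_complement n m" "x \<in> T" "y \<in> T"
    using xy unfolding connected_component_def by blast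
  have sign: "x i - x j < real k \<longleftrightarrow> y i - y j < real k"
    if ijk: "1 \<le> i" "i < j" "j \<le> n + 1" "k \<le> m" for i j k
  proof -
    define g where "g v = v i - v j" for v :: "nat \<Rightarrow> real"
    have "continuous_on T g" unfolding g_def
      by (intro continuous_on_diff continuous_on_subset[OF continuous_on_product_coordinates]) auto
    hence conn: "connected (g ` T)" using T(1) by (rule connected_continuous_image)
    have "g v \<noteq> real k" if "v \<in> T" for v
    proof -
      have "v \<in> cat_complement n m" using T(2) that by blast
      thus ?thesis using ijk unfolding g_def cat_complement_iff by blast
    qed
    hence "real k \<notin> g ` T" by force
    moreover have "g x \<in> g ` T" "g y \<in> g ` T" using T by auto
    ultimately have "g x < real k \<longleftrightarrow> g y < real k"
      using connectedD_interval[OF conn, of "g x" "g y" "real k"]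
        connectedD_interval[OF conn, of "g y" "g x" "real k"] by (metis less_le_not_le linorder_le_cases)
    thus ?thesis by (simp add: g_def)
  qed
  have y: "y \<in> cat_complement n m" using T by blast
  thus "y \<in> Vsp n" by (simp add: cat_complement_iff)
  have ne: "y i - y j \<noteq> real k" if "1 \<le> i" "i < j" "j \<le> n + 1" "k \<le> m" for i j k
    using y that unfolding cat_complement_iff by blast
  have "y j < y i" if "1 \<le> i" "i < j" "j \<le> n + 1" for i j
    using sign[OF that, of 0] ne[OF that, of 0] genericD(1)[OF x(2) that] by simp
  thus "generic (n + 1) m y" using ne by (auto simp: generic_def)
  show "same_pattern (n + 1) m x y" using sign by (auto simp: same_pattern_def)
qed

lemma component_eq_cell:
  assumes x: "x \<in> Vsp n" "generic (n + 1) m x"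
  shows "connected_component_set (cat_complement n m) x = cell n m (below_seq n m x)"
proof (intro equalityI subsetI)
  fix y assume "y \<in> connected_component_set (cat_complement n m) x"
  hence "connected_component (cat_complement n m) x y" by simp
  from connected_same_pattern[OF x this] show "y \<in> cell n m (below_seq n m x)"
    using same_pattern_below_seq[of n m x y] by (simp add: cell_def)
next
  fix y assume "y \<in> cell n m (below_seq n m x)"
  hence y: "y \<in> Vsp n" "generic (n + 1) m y" "below_seq n m x = below_seq n m y"
    by (simp_all add: cell_def)
  have "same_pattern (n + 1) m x y" by (rule below_seq_eq_imp_same_pattern[OF x(2) y(2,3)])
  thus "y \<in> connected_component_set (cat_complement n m) x"
    using same_pattern_connected[OF x y(1,2)] by simp
qed

lemma dom_regions_eq:
  "dom_regions n m = {cell n m (below_seq n m x) | x. x \<in> Vsp n \<and> generic (n + 1) m x}"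
proof (intro equalityI subsetI)
  fix R assume "R \<in> dom_regions n m"
  then obtain x where x: "x \<in> cat_complement n m" "R = connected_component_set (cat_complement n m) x"
    "R \<subseteq> dominant_chamber n" by (auto simp: dom_regions_def cat_regions_def)
  hence "x \<in> R" by simp
  hence "x \<in> dominant_chamber n" using x by blast
  hence "x \<in> Vsp n" "generic (n + 1) m x" using x(1) dominant_complement_iff by blast+
  thus "R \<in> {cell n m (below_seq n m x) | x. x \<in> Vsp n \<and> generic (n + 1) m x}"
    using x(2) component_eq_cell by blast
next
  fix R assume "R \<in> {cell n m (below_seq n m x) | x. x \<in> Vsp n \<and> generic (n + 1) m x}"
  then obtain x where x: "x \<in> Vsp n" "generic (n + 1) m x" "R = cell n m (below_seq n m x)" by blast
  have "x \<in> cat_complement n m" using x dominant_complement_iff by blast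
  moreover have "R = connected_component_set (cat_complement n m) x" using component_eq_cell[OF x(1,2)] x(3) by simp
  moreover have "R \<subseteq> dominant_chamber n"
    unfolding x(3) cell_def using dominant_complement_iff by blast
  ultimately show "R \<in> dom_regions n m" unfolding dom_regions_def cat_regions_def by blast
qed

text \<open>Points built coordinate by coordinate need not have sum zero. Subtracting the mean moves
  them into \<open>Vsp n\<close> and keeps all coordinate differences.\<close>

definition center :: "nat \<Rightarrow> (nat \<Rightarrow> real) \<Rightarrow> nat \<Rightarrow> real" where
  "center n x = (\<lambda>l. if l \<in> {1..n + 1} then x l - (\<Sum>j=1..n+1. x j) / (n + 1) else 0)"

lemma center_mem_Vsp: "center n x \<in> Vsp n"
proof -
  have "(\<Sum>l=1..n+1. center n x l) = (\<Sum>l=1..n+1. x l - (\<Sum>j=1..n+1. x j) / (n + 1))"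
    by (intro sum.cong) (auto simp: center_def)
  also have "\<dots> = 0" by (simp add: sum_subtractf del: sum.cl_ivl_Suc)
  finally show ?thesis by (auto simp: Vsp_def center_def)
qed

lemma center_diff:
  "1 \<le> i \<Longrightarrow> i \<le> n + 1 \<Longrightarrow> 1 \<le> j \<Longrightarrow> j \<le> n + 1 \<Longrightarrow> center n x i - center n x j = x i - x j"
  by (simp add: center_def)

lemma generic_center:
  assumes "generic (n + 1) m x"
  shows "generic (n + 1) m (center n x)"
proof -
  have d: "center n x i - center n x j = x i - x j" if "1 \<le> i" "i < j" "j \<le> n + 1" for i j
    using that by (intro center_diff) auto
  show ?thesis unfolding generic_def
  proof (intro allI impI)
    fix i j assume ij: "1 \<le> i \<and> i < j \<and> j \<le> n + 1"
    thus "center n x j < center n x i \<and> (\<forall>k\<in>{1..m}. center n x i - center n x j \<noteq> real k)"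
      using d[of i j] genericD[OF assms, of i j] by auto
  qed
qed

lemma below_seq_center: "below_seq n m (center n x) = below_seq n m x"
proof (rule same_pattern_below_seq)
  have d: "center n x i - center n x j = x i - x j" if "1 \<le> i" "i < j" "j \<le> n + 1" for i j
    using that by (intro center_diff) auto
  show "same_pattern (n + 1) m (center n x) x" unfolding same_pattern_def using d by simp
qed

section \<open>Ballot sequences, dominant regions and their separating walls\<close>

lemma cell_nonempty:
  assumes "b \<in> ballot_seqs n m"
  obtains x where "x \<in> Vsp n" "generic (n + 1) m x" "below_seq n m x = b"
proof -
  have b: "length b = n + 1" "b ! 0 = 0" "\<And>i. i < n \<Longrightarrow> b ! Suc i \<le> b ! i + m"
    using assms by (auto simp: ballot_seqs_def)
  from ex_generic_below[of "(!) b" n m, OF b(2,3)] obtain x where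
    x: "generic (n + 1) m x" "\<And>i. i \<le> n \<Longrightarrow> card (below m x i (x (i + 1))) = b ! i" by blast
  have "below_seq n m x = b"
    by (rule nth_equalityI) (use b x in \<open>auto simp: below_seq_nth\<close>)
  thus ?thesis using that[of "center n x"] center_mem_Vsp generic_center[OF x(1)] below_seq_center
    by simp
qed

lemma below_seq_mem_ballot_seqs:
  "generic (n + 1) m x \<Longrightarrow> below_seq n m x \<in> ballot_seqs n m"
  using below_seq_ballot[of n m x] by (simp add: ballot_seqs_def below_seq_nth)

text \<open>Injectivity rests on the cells being nonempty, since any point of a cell recovers the
  sequence.\<close>

lemma bij_betw_cell: "bij_betw (cell n m) (ballot_seqs n m) (dom_regions n m)"
proof (intro bij_betw_imageI inj_onI equalityI subsetI)
  fix b b' assume *: "b \<in> ballot_seqs n m" "b' \<in> ballot_seqs n m" "cell n m b = cell n m b'"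
  from *(1) obtain x where "x \<in> Vsp n" "generic (n + 1) m x" "below_seq n m x = b"
    by (rule cell_nonempty)
  hence "x \<in> cell n m b" "x \<in> cell n m b'" using *(3) by (auto simp: cell_def)
  thus "b = b'" by (simp add: cell_def)
next
  fix R assume "R \<in> cell n m ` ballot_seqs n m"
  then obtain b where b: "b \<in> ballot_seqs n m" "R = cell n m b" by blast
  from b(1) obtain x where "x \<in> Vsp n" "generic (n + 1) m x" "below_seq n m x = b"
    by (rule cell_nonempty)
  thus "R \<in> dom_regions n m" unfolding dom_regions_eq b(2) by blast
next
  fix R assume "R \<in> dom_regions n m"
  thus "R \<in> cell n m ` ballot_seqs n m"
    unfolding dom_regions_eq using below_seq_mem_ballot_seqs by blast
qed

text \<open>Lowering the coordinates \<open>x\<^sub>1, \<dots>, x\<^sub>i\<close> simultaneously until \<open>x\<^sub>i - x\<^sub>i\<^sub>+\<^sub>1 = m\<close> meets no other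
  hyperplane, because \<open>x\<^sub>a - x\<^sub>b > m\<close> persists for all other \<open>a \<le> i < b\<close>.\<close>

lemma is_wall_simple_root:
  assumes x: "x \<in> Vsp n" "generic (n + 1) m x" and i: "1 \<le> i" "i \<le> n"
    and gt: "x i - x (i + 1) > real m"
  shows "is_wall n m (hyp n (simpleroot i) (int m)) (cell n m (below_seq n m x))"
proof -
  define t where "t = x i - x (i + 1) - real m"
  \<comment> \<open>At time \<open>s\<close> the first \<open>i\<close> coordinates have been
    lowered by \<open>s * t\<close>, where \<open>t\<close> is the excess of
    \<open>x i - x (i + 1)\<close> over \<open>m\<close>; the hyperplane is reached at
    \<open>s = 1\<close>.\<close>
  define w where "w s = (\<lambda>l. x l - (if l \<le> i then s * t else 0))" for s :: real
  define f where "f s = center n (w s)" for s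
  have t: "0 < t" using gt by (simp add: t_def)
  have mono: "x b \<le> x a" if "1 \<le> a" "a \<le> b" "b \<le> n + 1" for a b
    using genericD(1)[OF x(2), of a b] that by (cases "a = b") auto
  have diff: "f s a - f s b = x a - x b - (if a \<le> i \<and> i < b then s * t else 0)"
    if "1 \<le> a" "a < b" "b \<le> n + 1" for s a b
    unfolding f_def using that center_diff[of a n b "w s"] by (auto simp: w_def)
  have cross: "f s a - f s b \<ge> real m + (1 - s) * t"
    if "1 \<le> a" "a \<le> i" "i < b" "b \<le> n + 1" for s a b
  proof -
    have "x i \<le> x a" "x b \<le> x (i + 1)" using that by (auto intro!: mono)
    thus ?thesis using diff[of a b s] that by (simp add: t_def algebra_simps)
  qed
  \<comment> \<open>Any other pair straddling the cut has a strictly larger difference, so at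
    \<open>s = 1\<close> it still exceeds \<open>m\<close>.\<close>
  have cross1: "f s a - f s b > real m + (1 - s) * t"
    if "1 \<le> a" "a \<le> i" "i < b" "b \<le> n + 1" "(a, b) \<noteq> (i, i + 1)" for s a b
  proof -
    have "x i \<le> x a" "x b \<le> x (i + 1)" using that by (auto intro!: mono)
    moreover have "x i < x a \<or> x b < x (i + 1)"
      using that genericD(1)[OF x(2), of a i] genericD(1)[OF x(2), of "i + 1" b] by fastforce
    ultimately show ?thesis using diff[of a b s] that by (simp add: t_def algebra_simps) linarith
  qed
  have in_cell: "f s \<in> cell n m (below_seq n m x)" if s: "0 \<le> s" "s < 1" for s
  proof -
    have far: "f s a - f s b > real m \<and> x a - x b > real m"
      if "1 \<le> a" "a \<le> i" "i < b" "b \<le> n + 1" for a b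
    proof -
      have "0 < (1 - s) * t" "0 \<le> s * t" using s t by simp_all
      thus ?thesis using cross[OF that, of s] diff[of a b s] that by auto
    qed
    have gen: "generic (n + 1) m (f s)"
      unfolding generic_def
    proof (intro allI impI)
      fix a b assume ab: "1 \<le> a \<and> a < b \<and> b \<le> n + 1"
      show "f s b < f s a \<and> (\<forall>k\<in>{1..m}. f s a - f s b \<noteq> real k)"
      proof (cases "a \<le> i \<and> i < b")
        case True
        hence "real m < f s a - f s b" using far ab by blast
        moreover have "real k \<le> real m" if "k \<in> {1..m}" for k using that by simp
        ultimately show ?thesis by force
      next
        case False
        have "f s a - f s b = x a - x b" using diff[of a b s, unfolded if_not_P[OF False]] ab by simp
        thus ?thesis using genericD[OF x(2), of a b] ab by auto
      qed
    qed
    have "same_pattern (n + 1) m x (f s)"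
      unfolding same_pattern_def
    proof (intro allI impI)
      fix a b k assume ab: "1 \<le> a \<and> a < b \<and> b \<le> n + 1 \<and> k \<in> {1..m}"
      show "x a - x b < real k \<longleftrightarrow> f s a - f s b < real k"
      proof (cases "a \<le> i \<and> i < b")
        case True
        moreover have "real k \<le> real m" using ab by simp
        ultimately show ?thesis using far[of a b] ab by linarith
      next
        case False
        have "f s a - f s b = x a - x b" using diff[of a b s, unfolded if_not_P[OF False]] ab by simp
        thus ?thesis by simp
      qed
    qed
    from same_pattern_below_seq[OF this] show ?thesis
      using gen by (simp add: cell_def f_def center_mem_Vsp)
  qed
  have "continuous_on {0..1} f"
  proof (rule continuous_on_coordinatewise_then_product)
    fix l
    have w: "continuous_on {0..1} (\<lambda>s. w s j)" for j
      unfolding w_def by (cases "j \<le> i") (auto intro!: continuous_intros)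
    show "continuous_on {0..1} (\<lambda>s. f s l)"
      unfolding f_def center_def by (cases "l \<in> {1..n + 1}") (auto intro!: continuous_intros w)
  qed
  hence "f ` closure {0..<1} \<subseteq> closure (cell n m (below_seq n m x))"
    using in_cell closure_subset by (intro image_closure_subset) fastforce+
  hence closure: "f 1 \<in> closure (cell n m (below_seq n m x))" by auto
  have f1: "f 1 i - f 1 (i + 1) = real m" using diff[of i "i + 1" 1] i by (simp add: t_def)
  have sr: "is_posroot n (simpleroot i)"
    unfolding is_posroot_def simpleroot_def using i by blast
  have f1V: "f 1 \<in> Vsp n" by (simp add: f_def center_mem_Vsp)
  have mem: "f 1 \<in> hyp n (simpleroot i) (int m)"
    using f1 f1V ip_posroot[of i i n "f 1"] i by (simp add: hyp_def simpleroot_def)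
  have "H' = hyp n (simpleroot i) (int m)" if H': "H' \<in> cat_arr n m" "f 1 \<in> H'" for H'
  proof -
    obtain a c k where ac: "1 \<le> a" "a \<le> c" "c \<le> n" "k \<le> m" "H' = hyp n (posroot a c) (int k)"
      using H'(1) unfolding cat_arr_def is_posroot_def by blast
    have eq: "f 1 a - f 1 (c + 1) = real k"
      using H'(2) ac ip_posroot[of a c n "f 1"] by (simp add: hyp_def)
    show ?thesis
    \<comment> \<open>If the pair straddles the cut, its difference exceeds \<open>m\<close> unless
      it is \<open>(i, i + 1)\<close>. Otherwise its difference is the same as at \<open>x\<close>,
      which lies on no hyperplane.\<close>
    proof (cases "a \<le> i \<and> i < c + 1")
      case True
      have "real k \<le> real m" using ac by simp
      hence "(a, c + 1) = (i, i + 1)" using cross1[of a "c + 1" 1] True ac eq by fastforce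
      hence "a = i" "c = i" by auto
      moreover from this have "k = m" using eq f1 by simp
      ultimately show ?thesis using ac by (simp add: simpleroot_def)
    next
      case False
      have "x a - x (c + 1) = real k" using diff[of a "c + 1" 1, unfolded if_not_P[OF False]] eq ac by simp
      hence "\<not> (x \<in> cat_complement n m)" using ac unfolding cat_complement_iff by force
      thus ?thesis using x dominant_complement_iff by blast
    qed
  qed
  moreover have "hyp n (simpleroot i) (int m) \<in> cat_arr n m" using sr unfolding cat_arr_def by blast
  ultimately show ?thesis unfolding is_wall_def using closure mem by blast
qed

text \<open>The origin has value 0, which is less than \<open>m\<close>, so separation means that
  the difference exceeds \<open>m\<close> on the whole cell. This is decided by the entry
  \<open>b ! i\<close>, which all points of the cell share.\<close>

lemma is_sep_wall_cell_iff:
  assumes b: "b \<in> ballot_seqs n m" and i: "1 \<le> i" "i \<le> n" and m: "0 < m"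
  shows "is_sep_wall n m (simpleroot i) (int m) (cell n m b) \<longleftrightarrow> b ! i = 0"
proof -
  from b obtain x where x: "x \<in> Vsp n" "generic (n + 1) m x" "below_seq n m x = b"
    by (rule cell_nonempty)
  have ip: "ip n v (simpleroot i) = v i - v (i + 1)" for v
    using ip_posroot[of i i n v] i by (simp add: simpleroot_def)
  have zero: "b ! i = 0 \<longleftrightarrow> y i - y (i + 1) > real m" if "y \<in> cell n m b" for y
    using below_seq_eq_0_iff[of n m y i] that i m by (auto simp: cell_def)
  have "x \<in> cell n m b" using x by (simp add: cell_def)
  show ?thesis
  proof
    assume "is_sep_wall n m (simpleroot i) (int m) (cell n m b)"
    hence "\<forall>y\<in>cell n m b. y i - y (i + 1) > real m"
      using m by (auto simp: is_sep_wall_def ip)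
    thus "b ! i = 0" using zero \<open>x \<in> cell n m b\<close> by blast
  next
    assume *: "b ! i = 0"
    hence "is_wall n m (hyp n (simpleroot i) (int m)) (cell n m b)"
      using is_wall_simple_root[OF x(1,2) i] zero[OF \<open>x \<in> cell n m b\<close>] x(3) by simp
    moreover have "\<forall>y\<in>cell n m b. y i - y (i + 1) > real m" using * zero by blast
    ultimately show "is_sep_wall n m (simpleroot i) (int m) (cell n m b)"
      using m by (simp add: is_sep_wall_def ip)
  qed
qed

theorem theorem1p1:
  fixes n m :: nat
  assumes "0 < n" and "0 < m"
  shows "\<exists>\<omega>. bij_betw \<omega> (dissections n m) (dom_regions n m) \<and>
           (\<forall>i \<in> {1..n}. \<forall>D \<in> dissections n m.
              neg_simple_diag n m i \<in> D \<longleftrightarrow> is_sep_wall n m (simpleroot i) (int m) (\<omega> D))"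
proof -
  obtain h where h: "bij_betw h (dissections n m) (ballot_seqs n m)"
    "\<And>D i. D \<in> dissections n m \<Longrightarrow> i \<in> {1..n} \<Longrightarrow> neg_simple_diag n m i \<in> D \<longleftrightarrow> h D ! i = 0"
    using ex_bij_dissections_zeros[OF assms(2), of n] by blast
  have "bij_betw (cell n m \<circ> h) (dissections n m) (dom_regions n m)"
    by (rule bij_betw_trans[OF h(1) bij_betw_cell])
  moreover have "neg_simple_diag n m i \<in> D \<longleftrightarrow>
      is_sep_wall n m (simpleroot i) (int m) ((cell n m \<circ> h) D)"
    if "i \<in> {1..n}" "D \<in> dissections n m" for i D
    using h(2)[OF that(2,1)] is_sep_wall_cell_iff[OF bij_betwE[OF h(1), rule_format, OF that(2)]]
      that(1) assms(2) by simp
  ultimately show ?thesis by blast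
qed

end
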